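(* Let $\alpha\in(0,1)$, let $S=S_\alpha$, and let $(\Omega_S,J)$ be the almost complex manifold described in the context, with $\lambda(z_1,z_2)=-2|z_2|^\alpha$. If $0\neq b\in D_S$, then the Kobayashi-Royden pseudonorm of the tangent vector $(1,0)$ at the point $(0,b)\in\Omega_S$ satisfies $$\|(0,b),(1,0)\|_K\ge\frac{3}{4\sqrt2}.$$
   Context: For $R>0$, $D_R=\{z\in\mathbb{C}:|z|<R\}$. For $\alpha\in(0,1)$ define $$S_\alpha=\begin{cases}\left(\alpha(1-\alpha)\right)^{1/(2-2\alpha)}&\text{if }0<\alpha\le\frac23,\\[4pt]\left(\dfrac{4\alpha(1-\alpha)^2}{2-\alpha}\right)^{1/(2-2\alpha)}&\text{if }\frac23\le\alpha<1.\end{cases}$$ For $S>0$, let $\Omega_S=D_2\times D_S\subseteq\mathbb{C}^2$, regarded as an open subset of $\mathbb{R}^4$ with coordinates $\vec x=(x_1,y_1,x_2,y_2)=(z_1,z_2)$, $z_k=x_k+iy_k$, and with trivial tangent bundle $T\Omega_S\subseteq T\mathbb{R}^4$; tangent vectors in $T_{\vec x}\Omega_S=\mathbb{R}^4$ are also written as elements of $\mathbb{C}^2$, so $(1,0)\in\mathbb{C}^2$ is the vector $(1,0,0,0)\in\mathbb{R}^4$. Given a function $\lambda:\Omega_S\to\mathbb{R}$, the almost complex structure $J$ on $\Omega_S$ is given at $\vec x$ by the matrix $$J(\vec x)=\begin{pmatrix}0&-1&0&0\\1&0&0&0\\0&\lambda(\vec x)&0&-1\\\lambda(\vec x)&0&1&0\end{pmatrix}.$$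 For $r>0$, a map $Z:D_r\to\Omega_S$ is a $J$-holomorphic disk if $Z\in\mathcal{C}^1(D_r)$ and $dZ\circ J_{std}=J\circ dZ$, where $J_{std}$ is the standard complex structure on $D_r\subseteq\mathbb{C}$ (with coordinate $z=x+iy$, $J_{std}\frac{\partial}{\partial x}=\frac{\partial}{\partial y}$, $J_{std}\frac{\partial}{\partial y}=-\frac{\partial}{\partial x}$). The Kobayashi-Royden pseudonorm on $\Omega_S$ is the function $T\Omega_S\to\mathbb{R}$, $(\vec x,\vec v)\mapsto\|(\vec x,\vec v)\|_K$, where for $\vec v\in T_{\vec x}\Omega_S$, $\|(\vec x,\vec v)\|_K$ is the greatest lower bound of the set $$\left\{\tfrac1r:\ r>0,\ \exists\text{ a }J\text{-holomorphic }Z:D_r\to\Omega_S\text{ with }Z(0)=\vec x,\ dZ(0)\left(\tfrac{\partial}{\partial x}\right)=\vec v\right\}.$$ (For $\lambda\in\mathcal{C}^{0,\alpha}(\Omega_S)$ with $0<\alpha<1$ it is known that this set is nonempty, so the pseudonorm is well defined.) *)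

theory Defs
  imports "HOL-Analysis.Analysis"
begin

definition Dsk :: "real \<Rightarrow> complex set" where
  "Dsk R = {z. cmod z < R}"

definition S_alpha :: "real \<Rightarrow> real" where
  "S_alpha \<alpha> =
     (if \<alpha> \<le> 2 / 3
      then (\<alpha> * (1 - \<alpha>)) powr (1 / (2 - 2 * \<alpha>))
      else (4 * \<alpha> * (1 - \<alpha>)\<^sup>2 / (2 - \<alpha>)) powr (1 / (2 - 2 * \<alpha>)))"

text \<open>The identification of pairs of complex numbers with real 4-vectors
  (coordinates \<open>x\<^sub>1, y\<^sub>1, x\<^sub>2, y\<^sub>2\<close> in this order), and the complex coordinates
  \<open>z\<^sub>1, z\<^sub>2\<close> of a real 4-vector.\<close>

definition vec_of_C2 :: "complex \<Rightarrow> complex \<Rightarrow> real ^ 4" where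
  "vec_of_C2 z1 z2 = vector [Re z1, Im z1, Re z2, Im z2]"

definition zc1 :: "real ^ 4 \<Rightarrow> complex" where
  "zc1 x = Complex (x $ 1) (x $ 2)"

definition zc2 :: "real ^ 4 \<Rightarrow> complex" where
  "zc2 x = Complex (x $ 3) (x $ 4)"

definition Omega :: "real \<Rightarrow> (real ^ 4) set" where
  "Omega S = {x. zc1 x \<in> Dsk 2 \<and> zc2 x \<in> Dsk S}"

text \<open>Only the values of \<open>\<lambda>\<close> on \<open>Omega S\<close> matter below.\<close>

definition Jmat :: "(real ^ 4 \<Rightarrow> real) \<Rightarrow> real ^ 4 \<Rightarrow> real ^ 4 ^ 4" where
  "Jmat lam x = vector
     [vector [0,     -1,    0,  0],
      vector [1,      0,    0,  0],
      vector [0,      lam x, 0, -1],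
      vector [lam x,  0,    1,  0]]"

definition C1_on :: "('a::real_normed_vector \<Rightarrow> 'b::real_normed_vector) \<Rightarrow> 'a set \<Rightarrow> bool" where
  "C1_on f U \<longleftrightarrow>
     (\<exists>f' :: 'a \<Rightarrow> ('a \<Rightarrow>\<^sub>L 'b).
        (\<forall>z\<in>U. (f has_derivative blinfun_apply (f' z)) (at z)) \<and> continuous_on U f')"

text \<open>The standard complex structure sends the tangent vector \<open>h\<close> of the disk to \<open>\<i> * h\<close>.
  Values of \<open>Z\<close> outside the open disk are irrelevant.\<close>

definition J_holomorphic_disk ::
  "real \<Rightarrow> (real ^ 4 \<Rightarrow> real) \<Rightarrow> real \<Rightarrow> (complex \<Rightarrow> real ^ 4) \<Rightarrow> bool" where
  "J_holomorphic_disk S lam r Z \<longleftrightarrow>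
     Z ` Dsk r \<subseteq> Omega S \<and> C1_on Z (Dsk r) \<and>
     (\<forall>z\<in>Dsk r. \<forall>h.
        frechet_derivative Z (at z) (\<i> * h) = Jmat lam (Z z) *v frechet_derivative Z (at z) h)"

text \<open>The tangent vector \<open>\<partial>/\<partial>x\<close> of the disk is \<open>1 :: complex\<close>.  The real-valued infimum is the
  greatest lower bound only when the set is nonempty (it is bounded below by 0).\<close>

definition KR_pseudonorm ::
  "real \<Rightarrow> (real ^ 4 \<Rightarrow> real) \<Rightarrow> real ^ 4 \<Rightarrow> real ^ 4 \<Rightarrow> real" where
  "KR_pseudonorm S lam x v =
     Inf {1 / r | r. r > 0 \<and>
            (\<exists>Z. J_holomorphic_disk S lam r Z \<and> Z 0 = x \<and> frechet_derivative Z (at 0) 1 = v)}"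

end

theory Submission
  imports Defs "HOL-Complex_Analysis.Complex_Analysis"
begin

text \<open>
  Write a \<open>J\<close>-holomorphic disk as \<open>(w, h)\<close>.  Then \<open>w\<close> is holomorphic and \<open>h\<close> solves
  \<open>\<partial>h/\<partial>z\<bar> = |h|\<^sup>\<alpha> cnj w'\<close>.  If the radius exceeds \<open>4 \<surd>2 / 3\<close>, then by the Schwarz--Pick lemma
  there is a smaller concentric disk on which \<open>w' \<noteq> 0\<close> and on whose boundary \<open>|w| \<ge> 1\<close>.  There the
  function \<open>|h|\<close> to the power \<open>2 - 2\<alpha>\<close>, minus \<open>c |w|\<^sup>2\<close> with \<open>c = 4 (1 - \<alpha>)\<^sup>2 / (2 - \<alpha>)\<^sup>2\<close>, is
  positive at the centre and cannot have a positive interior maximum, so it is positive somewhere on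
  the boundary; but \<open>S\<^sub>\<alpha>\<close> to the power \<open>2 - 2\<alpha>\<close> is at most \<open>c\<close>, a contradiction.

  Since \<open>h\<close> is only \<open>C\<^sup>1\<close>, the Laplacian of \<open>log |h|\<close> at the maximum is read off from means over
  small circles: their derivative in the radius involves \<open>\<partial>/\<partial>z\<bar>\<close> only, and \<open>\<partial>h/\<partial>z\<bar>\<close> is
  differentiable by the equation.
\<close>

subsection \<open>Circle means and the Wirtinger derivative\<close>

lemma integral_cis_multiple:
  fixes k :: int
  assumes "k \<noteq> 0"
  shows "((\<lambda>t. cis (of_int k * t)) has_integral 0) {0..2*pi}"
proof -
  have "((\<lambda>t. cis (of_int k * t)) has_integral
      (cis (of_int k * (2*pi)) / (\<i> * of_int k) - cis (of_int k * 0) / (\<i> * of_int k))) {0..2*pi}"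
  proof (rule fundamental_theorem_of_calculus)
    fix t :: real
    show "((\<lambda>t. cis (of_int k * t) / (\<i> * of_int k)) has_vector_derivative cis (of_int k * t)) (at t within {0..2*pi})"
      unfolding has_vector_derivative_def using assms
      by (auto intro!: derivative_eq_intros simp: scaleR_conv_of_real field_simps)
  qed auto
  moreover have "cis (of_int k * (2*pi)) = 1"
    by (metis Ints_of_int cis_multiple_2pi mult.commute)
  ultimately show ?thesis by simp
qed

text \<open>\<open>A\<close> and \<open>P\<close> are the two Wirtinger derivatives of
  \<open>g\<close>. The radial derivative of the integrand is \<open>A cis t + P cis (-t)\<close>;
  the difference of these two terms is, up to a constant factor, the derivative of \<open>g\<close>
  along the closed circle, so both have the same integral.\<close>

lemma circle_integral_derivative:
  fixes g A P :: "complex \<Rightarrow> complex"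
  assumes der: "\<And>z. z \<in> ball p e \<Longrightarrow> (g has_derivative (\<lambda>v. A z * v + P z * cnj v)) (at z)"
    and cA: "continuous_on (ball p e) A" and cP: "continuous_on (ball p e) P"
    and \<rho>: "0 < \<rho>" "\<rho> < e"
  shows "((\<lambda>\<rho>. integral {0..2*pi} (\<lambda>t. g (p + of_real \<rho> * cis t))) has_vector_derivative
     2 * integral {0..2*pi} (\<lambda>t. P (p + of_real \<rho> * cis t) * cis (-t))) (at \<rho>)"
proof -
  define U where "U = {-e<..<e}"
  have inb: "p + of_real x * cis t \<in> ball p e" if "x \<in> U" for x t
    using that by (auto simp: U_def dist_norm norm_mult)
  define D where "D = (\<lambda>x t. A (p + of_real x * cis t) * cis t + P (p + of_real x * cis t) * cis (-t))"
  have contg: "continuous_on (ball p e) g"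
    using der by (meson continuous_at_imp_continuous_on has_derivative_continuous)
  have 1: "((\<lambda>x. integral (cbox 0 (2*pi)) (\<lambda>t. g (p + of_real x * cis t))) has_vector_derivative
      integral (cbox 0 (2*pi)) (D \<rho>)) (at \<rho> within U)"
  proof (rule leibniz_rule_vector_derivative)
    fix x t assume "x \<in> U"
    have "((\<lambda>x. p + of_real x * cis t) has_derivative (\<lambda>h. of_real h * cis t)) (at x within U)"
      by (auto intro!: derivative_eq_intros)
    from has_derivative_compose[OF this der[OF inb[OF \<open>x \<in> U\<close>]]]
    show "((\<lambda>x. g (p + of_real x * cis t)) has_vector_derivative D x t) (at x within U)"
      unfolding has_vector_derivative_def D_def
      by (rule has_derivative_eq_rhs) (auto simp: scaleR_conv_of_real algebra_simps cis_cnj)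
  next
    fix x assume "x \<in> U"
    show "(\<lambda>t. g (p + of_real x * cis t)) integrable_on cbox 0 (2*pi)"
      by (intro integrable_continuous continuous_on_compose2[OF contg] continuous_intros)
         (use inb \<open>x \<in> U\<close> in auto)
  next
    show "continuous_on (U \<times> cbox 0 (2*pi)) (\<lambda>(x, t). D x t)"
      unfolding D_def split_beta
      by (intro continuous_intros continuous_on_compose2[OF cA] continuous_on_compose2[OF cP])
         (use inb in auto)
  qed (use \<rho> in \<open>auto simp: U_def\<close>)
  have \<rho>U: "\<rho> \<in> U" using \<rho> by (auto simp: U_def)
  \<comment> \<open>The tangential derivative integrates to zero, which turns the holomorphic part of the radial
    derivative into the antiholomorphic one.\<close>
  define T where "T = (\<lambda>t. A (p + of_real \<rho> * cis t) * cis t - P (p + of_real \<rho> * cis t) * cis (-t))"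
  have "((\<lambda>t. \<i> * of_real \<rho> * T t) has_integral
     (g (p + of_real \<rho> * cis (2*pi)) - g (p + of_real \<rho> * cis 0))) {0..2*pi}"
  proof (rule fundamental_theorem_of_calculus)
    fix t
    have "((\<lambda>t. p + of_real \<rho> * cis t) has_derivative (\<lambda>h. of_real \<rho> * (h *\<^sub>R (\<i> * cis t)))) (at t within {0..2*pi})"
      by (auto intro!: derivative_eq_intros)
    from has_derivative_compose[OF this der[OF inb[OF \<rho>U]]]
    show "((\<lambda>t. g (p + of_real \<rho> * cis t)) has_vector_derivative \<i> * of_real \<rho> * T t) (at t within {0..2*pi})"
      unfolding has_vector_derivative_def T_def
      by (rule has_derivative_eq_rhs) (auto simp: scaleR_conv_of_real algebra_simps cis_cnj)
  qed auto
  then have "((\<lambda>t. \<i> * of_real \<rho> * T t) has_integral 0) {0..2*pi}"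
    by simp
  then have "((\<lambda>t. inverse (\<i> * of_real \<rho>) * (\<i> * of_real \<rho> * T t)) has_integral inverse (\<i> * of_real \<rho>) * 0) {0..2*pi}"
    by (rule has_integral_mult_right)
  moreover have "inverse (\<i> * of_real \<rho>) * (\<i> * of_real \<rho> * x) = x" for x
    using \<rho> by (simp add: field_simps)
  ultimately have T0: "(T has_integral 0) {0..2*pi}"
    by simp
  have "(\<lambda>t. P (p + of_real \<rho> * cis t) * cis (-t)) integrable_on {0..2*pi}"
    by (intro integrable_continuous_real continuous_intros continuous_on_compose2[OF cP])
       (use inb \<rho>U in auto)
  then have "((\<lambda>t. 2 * (P (p + of_real \<rho> * cis t) * cis (-t))) has_integral
       2 * integral {0..2*pi} (\<lambda>t. P (p + of_real \<rho> * cis t) * cis (-t))) {0..2*pi}"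
    by (intro has_integral_mult_right integrable_integral)
  from has_integral_add[OF T0 this]
  have "(D \<rho> has_integral 2 * integral {0..2*pi} (\<lambda>t. P (p + of_real \<rho> * cis t) * cis (-t))) {0..2*pi}"
    by (simp add: D_def T_def algebra_simps)
  then have "integral {0..2*pi} (D \<rho>) = 2 * integral {0..2*pi} (\<lambda>t. P (p + of_real \<rho> * cis t) * cis (-t))"
    by (rule integral_unique)
  with 1 show ?thesis
    using at_within_open[OF \<rho>U] by (simp add: U_def)
qed

text \<open>Formally \<open>4 * B\<close> is the Laplacian of \<open>g\<close> at \<open>p\<close>,
  but \<open>P\<close> need be differentiable at that one point only. Integrating the radial
  derivative from \<open>0\<close> to a small radius \<open>s\<close> shows that the circle mean of
  \<open>Re g\<close> grows by nearly \<open>Re B * s\<^sup>2\<close>, while the quadratic bound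
  allows at most \<open>K * s\<^sup>2\<close>.\<close>

lemma Re_dbar_derivative_le:
  fixes g A P :: "complex \<Rightarrow> complex"
  assumes e: "e > 0"
    and der: "\<And>z. z \<in> ball p e \<Longrightarrow> (g has_derivative (\<lambda>v. A z * v + P z * cnj v)) (at z)"
    and cA: "continuous_on (ball p e) A" and cP: "continuous_on (ball p e) P"
    and dP: "(P has_derivative (\<lambda>v. B * v + C * cnj v)) (at p)"
    and le: "\<And>z. z \<in> ball p e \<Longrightarrow> Re (g z) \<le> Re (g p) + K * (cmod (z - p))\<^sup>2"
  shows "Re B \<le> K"
proof (rule field_le_epsilon)
  fix \<epsilon> :: real assume \<epsilon>: "0 < \<epsilon>"
  obtain d where d: "d > 0" "\<And>z. cmod (z - p) < d \<Longrightarrow>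
      cmod (P z - P p - (B * (z - p) + C * cnj (z - p))) \<le> \<epsilon> * cmod (z - p)"
    using dP \<epsilon> unfolding has_derivative_at_alt by meson
  define s where "s = min d e / 2"
  have s: "0 < s" "s < d" "s < e" using d e by (auto simp: s_def min_def field_simps)
  define M where "M = (\<lambda>\<rho>. integral {0..2*pi} (\<lambda>t. g (p + of_real \<rho> * cis t)))"
  define I where "I = (\<lambda>\<rho>. integral {0..2*pi} (\<lambda>t. P (p + of_real \<rho> * cis t) * cis (-t)))"
  have dist: "dist p (p + of_real x * cis t) = \<bar>x\<bar>" for x t
    by (simp add: dist_norm norm_mult)
  have contg: "continuous_on (ball p e) g"
    using der by (meson continuous_at_imp_continuous_on has_derivative_continuous)
  have M': "(M has_vector_derivative 2 * I \<rho>) (at \<rho>)" if "0 < \<rho>" "\<rho> < e" for \<rho>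
    unfolding M_def I_def by (rule circle_integral_derivative[OF der cA cP that])
  have I: "cmod (I \<rho> - of_real (2 * pi * \<rho>) * B) \<le> 2 * pi * (\<epsilon> * \<rho>)" if \<rho>: "0 < \<rho>" "\<rho> < s" for \<rho>
  proof -
    have Pint: "(\<lambda>t. P (p + of_real \<rho> * cis t) * cis (-t)) integrable_on {0..2*pi}"
      by (intro integrable_continuous_real continuous_intros continuous_on_compose2[OF cP])
         (use \<rho> s in \<open>auto simp: dist\<close>)
    \<comment> \<open>After multiplication by \<open>cis (-t)\<close>, the first-order expansion of
      \<open>P\<close> has frequencies -1, 0 and -2; only the term with \<open>B\<close> survives
      integration.\<close>
    have "((\<lambda>t. P p * cis (of_int (-1) * t) + of_real \<rho> * B + C * of_real \<rho> * cis (of_int (-2) * t)) has_integral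
       P p * 0 + (2 * pi - 0) *\<^sub>R (of_real \<rho> * B) + C * of_real \<rho> * 0) {0..2*pi}"
      by (intro has_integral_add has_integral_mult_right integral_cis_multiple has_integral_const_real[THEN has_integral_eq_rhs]) auto
    from has_integral_diff[OF integrable_integral[OF Pint] this]
    have "((\<lambda>t. P (p + of_real \<rho> * cis t) * cis (-t) - (P p * cis (-t) + of_real \<rho> * B + C * of_real \<rho> * cis (-2 * t)))
       has_integral (I \<rho> - of_real (2 * pi * \<rho>) * B)) (cbox 0 (2*pi))"
      by (simp add: I_def scaleR_conv_of_real mult.assoc)
    then have "cmod (I \<rho> - of_real (2 * pi * \<rho>) * B) \<le> (\<epsilon> * \<rho>) * measure lborel (cbox 0 (2*pi))"
    proof (rule has_integral_bound[rotated])
      fix t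
      have "P (p + of_real \<rho> * cis t) * cis (-t) - (P p * cis (-t) + of_real \<rho> * B + C * of_real \<rho> * cis (-2 * t))
        = (P (p + of_real \<rho> * cis t) - P p - (B * (of_real \<rho> * cis t) + C * cnj (of_real \<rho> * cis t))) * cis (-t)"
        by (simp add: algebra_simps cis_mult cis_cnj)
      then show "cmod (P (p + of_real \<rho> * cis t) * cis (-t) - (P p * cis (-t) + of_real \<rho> * B + C * of_real \<rho> * cis (-2 * t))) \<le> \<epsilon> * \<rho>"
        using d(2)[of "p + of_real \<rho> * cis t"] \<rho> s by (simp add: norm_mult)
    qed (use \<epsilon> \<rho> in auto)
    then show ?thesis by (simp add: mult_ac)
  qed
  \<comment> \<open>The circle integral minus the quadratic growth expected of it, reduced by
    \<epsilon>. The estimate \<open>I\<close> makes \<open>N\<close> nondecreasing on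
    \<open>{0..s}\<close>.\<close>
  define N where "N = (\<lambda>\<rho>. Re (M \<rho>) - 2 * pi * (Re B - \<epsilon>) * \<rho>\<^sup>2)"
  have "N 0 \<le> N s"
  proof (rule DERIV_nonneg_imp_increasing_open[where f = N])
    fix \<rho> assume \<rho>: "0 < \<rho>" "\<rho> < s"
    have "((\<lambda>\<rho>. Re (M \<rho>)) has_vector_derivative Re (2 * I \<rho>)) (at \<rho>)"
      using M'[of \<rho>] \<rho> s by (intro bounded_linear.has_vector_derivative[OF bounded_linear_Re]) auto
    moreover have "((\<lambda>\<rho>. 2 * pi * (Re B - \<epsilon>) * \<rho>\<^sup>2) has_real_derivative 2 * pi * (Re B - \<epsilon>) * (2 * \<rho>)) (at \<rho>)"
      by (auto intro!: derivative_eq_intros)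
    ultimately have "(N has_real_derivative Re (2 * I \<rho>) - 2 * pi * (Re B - \<epsilon>) * (2 * \<rho>)) (at \<rho>)"
      unfolding N_def has_real_derivative_iff_has_vector_derivative[symmetric] by (rule DERIV_diff)
    moreover have "0 \<le> Re (2 * I \<rho>) - 2 * pi * (Re B - \<epsilon>) * (2 * \<rho>)"
    proof -
      have "Re (of_real (2 * pi * \<rho>) * B - I \<rho>) \<le> 2 * pi * (\<epsilon> * \<rho>)"
        using I[OF \<rho>] complex_Re_le_cmod order_trans norm_minus_commute by metis
      then show ?thesis by (simp add: algebra_simps)
    qed
    ultimately show "\<exists>y. (N has_real_derivative y) (at \<rho>) \<and> 0 \<le> y" by blast
  next
    have "continuous_on {0..s} M"
      unfolding M_def
    proof (rule integral_continuous_on_param[where a=0 and b="2*pi", simplified])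
      show "continuous_on ({0..s} \<times> {0..2*pi}) (\<lambda>(x, t). g (p + of_real x * cis t))"
        unfolding split_beta
        by (intro continuous_intros continuous_on_compose2[OF contg]) (use s in \<open>auto simp: dist\<close>)
    qed
    then show "continuous_on {0..s} N"
      unfolding N_def by (intro continuous_intros)
  qed (use s in auto)
  then have "2 * pi * Re (g p) + 2 * pi * (Re B - \<epsilon>) * s\<^sup>2 \<le> Re (M s)"
    by (simp add: N_def M_def)
  also have "Re (M s) \<le> 2 * pi * (Re (g p) + K * s\<^sup>2)"
  proof -
    have "((\<lambda>t. g (p + of_real s * cis t)) has_integral M s) {0..2*pi}"
      unfolding M_def
      by (intro integrable_integral integrable_continuous_real continuous_intros continuous_on_compose2[OF contg])
         (use s in \<open>auto simp: dist\<close>)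
    then have 1: "((\<lambda>t. Re (g (p + of_real s * cis t))) has_integral Re (M s)) {0..2*pi}"
      by (rule has_integral_Re)
    have 2: "((\<lambda>t::real. Re (g p) + K * s\<^sup>2) has_integral (2*pi - 0) *\<^sub>R (Re (g p) + K * s\<^sup>2)) {0..2*pi}"
      by (rule has_integral_const_real[THEN has_integral_eq_rhs]) auto
    have "Re (M s) \<le> (2*pi - 0) *\<^sub>R (Re (g p) + K * s\<^sup>2)"
    proof (rule has_integral_le[OF 1 2])
      fix t
      show "Re (g (p + of_real s * cis t)) \<le> Re (g p) + K * s\<^sup>2"
        using le[of "p + of_real s * cis t"] s by (simp add: dist norm_mult)
    qed
    then show ?thesis by simp
  qed
  finally have "2 * pi * s\<^sup>2 * (Re B - \<epsilon>) \<le> 2 * pi * s\<^sup>2 * K"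
    by (simp add: algebra_simps)
  then show "Re B \<le> K + \<epsilon>"
    using s by (simp add: mult_le_cancel_left)
qed

subsection \<open>Comparison at an interior contact point\<close>

text \<open>\<open>Re g\<close> minus the quadratic term has a local maximum at \<open>p\<close>,
  and the quadratic term has zero differential there. The directions \<open>1\<close> and
  \<open>\<i>\<close> give the real and imaginary parts of the claim.\<close>

lemma Wirtinger_critical_point:
  fixes g :: "complex \<Rightarrow> complex"
  assumes e: "e > 0"
    and der: "(g has_derivative (\<lambda>v. a * v + b * cnj v)) (at p)"
    and le: "\<And>z. z \<in> ball p e \<Longrightarrow> Re (g z) \<le> Re (g p) + K * (cmod (z - p))\<^sup>2"
  shows "a = - cnj b"
proof -
  have 1: "((\<lambda>z. Re (g z)) has_derivative (\<lambda>v. Re (a * v + b * cnj v))) (at p)"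
    using der by (rule has_derivative_Re)
  have 2: "((\<lambda>z. K * ((z - p) \<bullet> (z - p))) has_derivative (\<lambda>v. 0)) (at p)"
    by (auto intro!: derivative_eq_intros)
  have "(\<lambda>v. Re (a * v + b * cnj v) - 0) = (\<lambda>v. 0)"
    by (rule differential_zero_maxmin[of p "ball p e", OF _ open_ball has_derivative_diff[OF 1 2]])
       (use e le in \<open>auto simp: power2_norm_eq_inner diff_le_eq intro!: disjI1\<close>)
  then have "Re (a * v + b * cnj v) = 0" for v
    by (metis diff_zero)
  from this[of 1] this[of \<i>] show ?thesis
    by (simp add: complex_eq_iff)
qed

lemma no_interior_contact:
  fixes h A w w' :: "complex \<Rightarrow> complex"
  assumes \<alpha>: "0 < \<alpha>" "\<alpha> < 1" and e: "e > 0"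
    and hd: "\<And>z. z \<in> ball p e \<Longrightarrow>
      (h has_derivative (\<lambda>v. A z * v + of_real (cmod (h z) powr \<alpha>) * cnj (w' z) * cnj v)) (at z)"
    and cA: "continuous_on (ball p e) A"
    and wd: "\<And>z. z \<in> ball p e \<Longrightarrow> (w has_field_derivative w' z) (at z)"
    and w'p: "w' p \<noteq> 0"
    and \<kappa>: "0 < \<kappa>" "(2 - \<alpha>) * \<kappa> \<le> 2 * (1 - \<alpha>)"
    and m: "m > 0"
    and eq: "cmod (h p) powr (2 * (1 - \<alpha>)) = \<kappa>\<^sup>2 * (cmod (w p))\<^sup>2 + m"
    and le: "\<And>z. z \<in> ball p e \<Longrightarrow>
      cmod (h z) powr (2 * (1 - \<alpha>)) \<le> \<kappa>\<^sup>2 * (cmod (w z))\<^sup>2 + m"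
  shows False
proof -
  define q where "q = \<kappa>\<^sup>2 * (cmod (w p))\<^sup>2 + m"
  have q: "q > 0" using m by (simp add: q_def add_nonneg_pos)
  have hp: "h p \<noteq> 0" using eq q \<alpha> by (auto simp: q_def[symmetric])
  \<comment> \<open>The exponent for which \<open>|h|\<close> to the power
    \<open>2 * (1 - \<alpha>)\<close> is compared with \<open>|E|\<^sup>2 / q\<close>, that is,
    \<open>|h|\<close> with a constant times \<open>|E|\<close> to the power \<gamma>.\<close>
  define \<gamma> where "\<gamma> = 1 / (1 - \<alpha>)"
  have \<gamma>: "\<gamma> > 0" "(1 - \<alpha>) * \<gamma> = 1" using \<alpha> by (auto simp: \<gamma>_def)
  \<comment> \<open>The polarisation of \<open>\<kappa>\<^sup>2 |w|\<^sup>2 + m\<close> with the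
    conjugate factor frozen at \<open>p\<close>: it is holomorphic and takes the value
    \<open>q\<close> at \<open>p\<close>.\<close>
  define E where "E = (\<lambda>z. of_real (\<kappa>\<^sup>2) * cnj (w p) * w z + of_real m)"
  define E' where "E' = (\<lambda>z. of_real (\<kappa>\<^sup>2) * cnj (w p) * w' z)"
  have Ep: "E p = of_real q"
    by (simp add: E_def q_def complex_norm_square[symmetric] mult_ac)
  have Ed: "(E has_field_derivative E' z) (at z)" if "z \<in> ball p e" for z
    unfolding E_def E'_def using wd[OF that] by (auto intro!: derivative_eq_intros)
  have pe: "p \<in> ball p e" using e by simp
  have holw: "w holomorphic_on ball p e"
    unfolding holomorphic_on_open[OF open_ball] using wd by blast
  have w'eq: "w' z = deriv w z" if "z \<in> ball p e" for z
    using wd[OF that] by (simp add: DERIV_imp_deriv)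
  have holw': "w' holomorphic_on ball p e"
    using holomorphic_deriv[OF holw open_ball] w'eq by (metis (full_types) holomorphic_cong)
  then obtain w2 where w2: "(w' has_field_derivative w2) (at p)"
    unfolding holomorphic_on_open[OF open_ball] using pe by blast
  have conth: "isCont h z" if "z \<in> ball p e" for z
    using hd[OF that] by (rule has_derivative_continuous)
  have contE: "isCont E z" if "z \<in> ball p e" for z
    using Ed[OF that] by (rule DERIV_isCont)
  \<comment> \<open>By continuity \<open>h / h p\<close> and \<open>E / q\<close> stay in the right
    half plane near \<open>p\<close>, where the principal logarithm is differentiable.\<close>
  have "eventually (\<lambda>z. Re (h z / h p) > 0) (at p)"
  proof (rule order_tendstoD)
    show "((\<lambda>z. Re (h z / h p)) \<longlongrightarrow> Re (h p / h p)) (at p)"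
      using conth[OF pe] hp by (intro tendsto_intros) (auto simp: isCont_def)
  qed (use hp in auto)
  moreover have "eventually (\<lambda>z. Re (E z / of_real q) > 0) (at p)"
  proof (rule order_tendstoD)
    show "((\<lambda>z. Re (E z / of_real q)) \<longlongrightarrow> Re (E p / of_real q)) (at p)"
      using contE[OF pe] q by (intro tendsto_intros) (auto simp: isCont_def)
  qed (use q Ep in auto)
  ultimately have "eventually (\<lambda>z. Re (h z / h p) > 0 \<and> Re (E z / of_real q) > 0) (at p)"
    by eventually_elim auto
  then obtain e1 where e1: "e1 > 0"
    "\<And>z. z \<noteq> p \<Longrightarrow> dist z p < e1 \<Longrightarrow> Re (h z / h p) > 0 \<and> Re (E z / of_real q) > 0"
    unfolding eventually_at by auto
  define e2 where "e2 = min e e1"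
  have e2: "e2 > 0" "ball p e2 \<subseteq> ball p e" using e e1 by (auto simp: e2_def)
  have pos: "Re (h z / h p) > 0" "Re (E z / of_real q) > 0" if "z \<in> ball p e2" for z
    using e1(2)[of z] that hp q Ep by (cases "z = p"; auto simp: e2_def dist_commute)+
  have nz: "h z \<noteq> 0" "E z \<noteq> 0" if "z \<in> ball p e2" for z
    using pos[OF that] by auto
  define L where "L = (\<lambda>z. Ln (h z / h p))"
  define g where "g = (\<lambda>z. L z - of_real \<gamma> * Ln (E z / of_real q))"
  define P where "P = (\<lambda>z. of_real (cmod (h z) powr \<alpha>) * cnj (w' z) / h z)"
  define G where "G = (\<lambda>z. A z / h z - of_real \<gamma> * E' z / E z)"
  have Ld: "(L has_derivative (\<lambda>v. A z / h z * v + P z * cnj v)) (at z)" if z: "z \<in> ball p e2" for z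
  proof -
    have "((\<lambda>z. h z / h p) has_derivative
       (\<lambda>v. (A z * v + of_real (cmod (h z) powr \<alpha>) * cnj (w' z) * cnj v) / h p)) (at z)"
      unfolding divide_inverse by (rule has_derivative_mult_left, rule hd) (use z e2 in auto)
    moreover have "(Ln has_derivative (*) (inverse (h z / h p))) (at (h z / h p))"
      using has_field_derivative_Ln[of "h z / h p"] pos[OF z]
      by (auto simp: has_field_derivative_def complex_nonpos_Reals_iff)
    ultimately have "((\<lambda>z. Ln (h z / h p)) has_derivative (\<lambda>v. inverse (h z / h p) *
       ((A z * v + of_real (cmod (h z) powr \<alpha>) * cnj (w' z) * cnj v) / h p))) (at z)"
      by (rule has_derivative_compose)
    then show ?thesis
      unfolding L_def by (rule has_derivative_eq_rhs) (use nz[OF z] hp in \<open>auto simp: P_def field_simps\<close>)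
  qed
  have gd: "(g has_derivative (\<lambda>v. G z * v + P z * cnj v)) (at z)" if z: "z \<in> ball p e2" for z
  proof -
    have "((\<lambda>z. Ln (E z / of_real q)) has_field_derivative E' z / E z) (at z)"
      using Ed[of z] z e2 pos[OF z] nz[OF z] q
      by (auto intro!: derivative_eq_intros simp: complex_nonpos_Reals_iff)
    then have "((\<lambda>z. Ln (E z / of_real q)) has_derivative (\<lambda>v. E' z / E z * v)) (at z)"
      unfolding has_field_derivative_def .
    from has_derivative_diff[OF Ld[OF z] has_derivative_mult_right[OF this, of "of_real \<gamma>"]]
    show ?thesis
      unfolding g_def by (rule has_derivative_eq_rhs) (auto simp: G_def algebra_simps)
  qed
  have ch: "continuous_on (ball p e2) h" and cE: "continuous_on (ball p e2) E"
    using conth contE e2 by (auto intro!: continuous_at_imp_continuous_on)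
  have cw': "continuous_on (ball p e2) w'"
    using holw' e2 by (meson continuous_on_subset holomorphic_on_imp_continuous_on)
  have cP: "continuous_on (ball p e2) P"
    unfolding P_def using nz by (intro continuous_intros ch cw') auto
  have cG: "continuous_on (ball p e2) G"
    unfolding G_def E'_def using nz
    by (intro continuous_intros ch cE cw' continuous_on_subset[OF cA e2(2)]) auto
  define A0 where "A0 = A p / h p"
  \<comment> \<open>\<open>B\<close> and \<open>C\<close> are the Wirtinger derivatives of
    \<open>P\<close> at \<open>p\<close>. With \<open>|h|\<^sup>\<alpha> / h\<close> read as h to
    the power \<alpha>/2 - 1 times its conjugate to the power \<alpha>/2, \<open>Peq\<close> writes
    \<open>P\<close> as the exponential of a combination of \<open>L\<close> and
    \<open>cnj L\<close>, times \<open>c0 * cnj w'\<close>. The factor \<open>cnj w'\<close> is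
    antiholomorphic and so adds nothing to \<open>B\<close>, only the term with \<open>w2\<close> to
    \<open>C\<close>.\<close>
  define B where "B = P p * (of_real (\<alpha>/2 - 1) * A0 + of_real (\<alpha>/2) * cnj (P p))"
  define c0 where "c0 = complex_of_real (cmod (h p) powr \<alpha>) / h p"
  define C where "C = P p * (of_real (\<alpha>/2 - 1) * P p + of_real (\<alpha>/2) * cnj A0)
     + c0 * cnj w2"
  have Peq: "P z = exp (of_real (\<alpha>/2 - 1) * L z + of_real (\<alpha>/2) * cnj (L z)) *
      (c0 * cnj (w' z))" if z: "z \<in> ball p e2" for z
  proof -
    have "of_real (\<alpha>/2 - 1) * L z + of_real (\<alpha>/2) * cnj (L z) = of_real (\<alpha> * Re (L z)) - L z"
      by (simp add: complex_eq_iff algebra_simps)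
    moreover have "exp (of_real (\<alpha> * Re (L z)) - L z) = of_real (cmod (h z / h p) powr \<alpha>) / (h z / h p)"
      using nz[OF z] hp by (simp add: exp_diff L_def powr_def Re_Ln norm_divide flip: exp_of_real)
    ultimately have X: "exp (of_real (\<alpha>/2 - 1) * L z + of_real (\<alpha>/2) * cnj (L z)) =
        of_real (cmod (h z / h p) powr \<alpha>) / (h z / h p)"
      by (simp only:)
    show ?thesis
      unfolding P_def X c0_def using nz[OF z] hp by (simp add: norm_divide powr_divide field_simps)
  qed
  have pe2: "p \<in> ball p e2" using e2 by simp
  have Lp: "L p = 0" using hp by (simp add: L_def)
  have dP: "(P has_derivative (\<lambda>v. B * v + C * cnj v)) (at p)"
  proof (rule has_derivative_transform_within_open[OF _ open_ball pe2 Peq[symmetric]])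
    have Ld0: "(L has_derivative (\<lambda>v. A0 * v + P p * cnj v)) (at p)"
      unfolding A0_def by (rule Ld[OF pe2])
    have Pp: "P p = c0 * cnj (w' p)" by (simp add: P_def c0_def)
    have w'd: "(w' has_derivative (\<lambda>v. w2 * v)) (at p)"
      using w2 by (simp add: has_field_derivative_def)
    define Q where "Q = (\<lambda>z. of_real (\<alpha>/2 - 1) * L z + of_real (\<alpha>/2) * cnj (L z))"
    have "(Q has_derivative (\<lambda>v. of_real (\<alpha>/2 - 1) * (A0 * v + P p * cnj v)
        + of_real (\<alpha>/2) * cnj (A0 * v + P p * cnj v))) (at p)"
      unfolding Q_def by (intro has_derivative_add has_derivative_mult_right has_derivative_cnj Ld0)
    then have expd: "((\<lambda>z. exp (Q z)) has_derivative (\<lambda>v. exp (Q p) * (of_real (\<alpha>/2 - 1) * (A0 * v + P p * cnj v)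
        + of_real (\<alpha>/2) * cnj (A0 * v + P p * cnj v)))) (at p)"
      by (rule has_derivative_compose[OF _ DERIV_exp[unfolded has_field_derivative_def]])
    have cw'd: "((\<lambda>z. c0 * cnj (w' z)) has_derivative (\<lambda>v. c0 * cnj (w2 * v))) (at p)"
      by (intro has_derivative_mult_right has_derivative_cnj w'd)
    show "((\<lambda>z. exp (of_real (\<alpha>/2 - 1) * L z + of_real (\<alpha>/2) * cnj (L z)) *
      (c0 * cnj (w' z))) has_derivative (\<lambda>v. B * v + C * cnj v)) (at p)"
      using has_derivative_mult[OF expd cw'd] unfolding Q_def
      by (rule has_derivative_eq_rhs) (auto simp: Lp B_def C_def Pp algebra_simps)
  qed
  \<comment> \<open>The limit, as \<open>z\<close> tends to \<open>p\<close>, of the bound in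
    \<open>Reg\<close> divided by the square of \<open>|z - p|\<close>.\<close>
  define k where "k = \<gamma> * \<kappa>\<^sup>2 * m * (cmod (w' p))\<^sup>2 / (2 * q\<^sup>2)"
  have Reg: "Re (g z) \<le> \<gamma> / 2 * (\<kappa>\<^sup>2 * m * (cmod (w z - w p))\<^sup>2 / (cmod (E z))\<^sup>2)" if z: "z \<in> ball p e2" for z
  proof -
    have ze: "z \<in> ball p e" using z e2 by auto
    define X where "X = \<kappa>\<^sup>2 * m * (cmod (w z - w p))\<^sup>2 / (cmod (E z))\<^sup>2"
    have X: "X \<ge> 0" using m by (simp add: X_def)
    \<comment> \<open>Lagrange's identity: up to a term of second order, \<open>\<kappa>\<^sup>2 |w|\<^sup>2 + m\<close> is the squared modulus of a
      holomorphic function, so subtracting its logarithm does not affect the \<open>z\<bar>\<close>-derivative.\<close>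
    have id: "q * (\<kappa>\<^sup>2 * (cmod (w z))\<^sup>2 + m) = (cmod (E z))\<^sup>2 + \<kappa>\<^sup>2 * m * (cmod (w z - w p))\<^sup>2"
      unfolding q_def E_def cmod_power2 by (simp add: power2_eq_square) algebra
    have "\<kappa>\<^sup>2 * (cmod (w z))\<^sup>2 + m = (cmod (E z))\<^sup>2 / q * (1 + X)"
    proof -
      have "(cmod (E z))\<^sup>2 * X = \<kappa>\<^sup>2 * m * (cmod (w z - w p))\<^sup>2"
        using nz[OF z] by (simp add: X_def)
      with id show ?thesis using q by (simp add: field_simps)
    qed
    then have "ln (cmod (h z) powr (2 * (1 - \<alpha>))) \<le> ln ((cmod (E z))\<^sup>2 / q * (1 + X))"
      using le[OF ze] nz[OF z] by (intro ln_mono) auto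
    also have "\<dots> = 2 * ln (cmod (E z)) - ln q + ln (1 + X)"
      using nz[OF z] q X by (simp add: ln_mult ln_div ln_realpow)
    also have "ln (1 + X) \<le> X" using X by (rule ln_add_one_self_le_self)
    finally have "2 * (1 - \<alpha>) * ln (cmod (h z)) \<le> 2 * ln (cmod (E z)) - ln q + X"
      using nz[OF z] by (simp add: ln_powr)
    moreover have lp: "2 * (1 - \<alpha>) * ln (cmod (h p)) = ln q"
      using arg_cong[OF eq, of ln] hp by (simp add: q_def ln_powr)
    moreover have Rg: "Re (g z) = ln (cmod (h z)) - ln (cmod (h p)) - \<gamma> * (ln (cmod (E z)) - ln q)"
      using nz[OF z] hp q by (simp add: g_def L_def norm_divide ln_div)
    moreover have "2 * ((1 - \<alpha>) * Re (g z)) = 2 * (1 - \<alpha>) * ln (cmod (h z)) - 2 * (1 - \<alpha>) * ln (cmod (h p))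
        - 2 * ((1 - \<alpha>) * \<gamma>) * (ln (cmod (E z)) - ln q)"
      unfolding Rg by (simp add: algebra_simps)
    ultimately have "2 * ((1 - \<alpha>) * Re (g z)) \<le> X"
      unfolding lp \<gamma>(2) by simp
    then have "\<gamma> * (2 * ((1 - \<alpha>) * Re (g z))) \<le> \<gamma> * X"
      using \<gamma> by (intro mult_left_mono) auto
    then have "2 * ((1 - \<alpha>) * \<gamma>) * Re (g z) \<le> \<gamma> * X"
      by (simp add: mult_ac)
    then have "2 * Re (g z) \<le> \<gamma> * X"
      using \<gamma> by simp
    then show ?thesis
      unfolding X_def[symmetric] by simp
  qed
  have gp: "g p = 0"
    using hp q by (simp add: g_def Lp Ep)
  \<comment> \<open>The bound with coefficient \<open>k\<close> holds only in the limit, so an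
    arbitrary \<open>K > k\<close> is used on a smaller ball; afterwards \<open>K\<close> decreases
    to \<open>k\<close>. The formula for \<open>A0\<close> does not depend on
    \<open>K\<close>.\<close>
  have main: "A0 = of_real \<gamma> * E' p / of_real q - cnj (P p) \<and> Re B \<le> K" if K: "k < K" for K
  proof -
    have "((\<lambda>z. \<gamma> / 2 * (\<kappa>\<^sup>2 * m * (cmod ((w z - w p) / (z - p)))\<^sup>2 / (cmod (E z))\<^sup>2)) \<longlongrightarrow>
        \<gamma> / 2 * (\<kappa>\<^sup>2 * m * (cmod (w' p))\<^sup>2 / (cmod (E p))\<^sup>2)) (at p)"
      using wd[OF pe] contE[OF pe] nz[OF pe2]
      by (intro tendsto_intros) (auto simp: has_field_derivative_iff isCont_def)
    moreover have "\<gamma> / 2 * (\<kappa>\<^sup>2 * m * (cmod (w' p))\<^sup>2 / (cmod (E p))\<^sup>2) = k"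
      using q by (simp add: k_def Ep)
    ultimately have "eventually (\<lambda>z. \<gamma> / 2 * (\<kappa>\<^sup>2 * m * (cmod ((w z - w p) / (z - p)))\<^sup>2 / (cmod (E z))\<^sup>2) < K) (at p)"
      using K by (intro order_tendstoD) auto
    then obtain d where d: "d > 0" "\<And>z. z \<noteq> p \<Longrightarrow> dist z p < d \<Longrightarrow>
        \<gamma> / 2 * (\<kappa>\<^sup>2 * m * (cmod ((w z - w p) / (z - p)))\<^sup>2 / (cmod (E z))\<^sup>2) < K"
      unfolding eventually_at by auto
    define e3 where "e3 = min d e2"
    have e3: "e3 > 0" "ball p e3 \<subseteq> ball p e2" using d e2 by (auto simp: e3_def)
    have bound: "Re (g z) \<le> Re (g p) + K * (cmod (z - p))\<^sup>2" if z: "z \<in> ball p e3" for z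
    proof (cases "z = p")
      case False
      have "Re (g z) \<le> \<gamma> / 2 * (\<kappa>\<^sup>2 * m * (cmod (w z - w p))\<^sup>2 / (cmod (E z))\<^sup>2)"
        using Reg z e3 by auto
      also have "\<dots> = \<gamma> / 2 * (\<kappa>\<^sup>2 * m * (cmod ((w z - w p) / (z - p)))\<^sup>2 / (cmod (E z))\<^sup>2) * (cmod (z - p))\<^sup>2"
        using False by (simp add: norm_divide power_divide)
      also have "\<dots> \<le> K * (cmod (z - p))\<^sup>2"
        using less_imp_le[OF d(2)[OF False]] z by (intro mult_right_mono) (auto simp: e3_def dist_commute)
      finally show ?thesis by (simp add: gp)
    qed simp
    have "G p = - cnj (P p)"
      by (rule Wirtinger_critical_point[OF e3(1) gd[OF pe2] bound])
    moreover have "Re B \<le> K"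
      by (rule Re_dbar_derivative_le[OF e3(1) gd _ _ dP bound])
         (use e3 in \<open>auto intro: continuous_on_subset[OF cG] continuous_on_subset[OF cP]\<close>)
    ultimately show ?thesis
      by (simp add: G_def A0_def Ep algebra_simps)
  qed
  have "Re B \<le> k"
    by (rule dense_ge) (use main in blast)
  have A0: "A0 = of_real \<gamma> * E' p / of_real q - cnj (P p)"
    using main[of "k + 1"] by simp
  define s where "s = sqrt q"
  have s: "s > 0" "q = s\<^sup>2" using q by (auto simp: s_def)
  have Pabs: "cmod (P p) = cmod (w' p) / s"
  proof -
    have "(cmod (h p) powr (1 - \<alpha>))\<^sup>2 = cmod (h p) powr (2 * (1 - \<alpha>))"
      by (simp add: power2_eq_square powr_add[symmetric])
    also have "\<dots> = s\<^sup>2"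
      using eq s by (simp add: q_def)
    finally have "(cmod (h p) powr (1 - \<alpha>))\<^sup>2 = s\<^sup>2" .
    then have "cmod (h p) powr (1 - \<alpha>) = s"
      by (rule power2_eq_imp_eq) (use s in auto)
    then have "cmod (h p) = cmod (h p) powr \<alpha> * s"
      using hp by (metis add.commute diff_add_cancel norm_ge_zero powr_add powr_one)
    then show ?thesis
      using hp s by (simp add: P_def norm_mult norm_divide field_simps)
  qed
  \<comment> \<open>Substituting the critical-point relation for \<open>A0\<close>, the coefficients
    1 - \<alpha>/2 and \<alpha>/2 of \<open>cnj (P p)\<close> add up to 1.\<close>
  have "B = P p * cnj (P p) - of_real ((1 - \<alpha>/2) * \<gamma> / q) * (P p * E' p)"
    unfolding B_def A0 using q by (simp add: field_simps)
  also have "P p * cnj (P p) = of_real ((cmod (P p))\<^sup>2)"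
    by (simp add: complex_norm_square[symmetric])
  finally have "Re B = (cmod (P p))\<^sup>2 - (1 - \<alpha>/2) * \<gamma> / q * Re (P p * E' p)"
    by simp
  moreover have "(1 - \<alpha>/2) * \<gamma> / q * Re (P p * E' p) \<le> (1 - \<alpha>/2) * \<gamma> / q * (cmod (P p) * cmod (E' p))"
    using \<gamma> q \<alpha> complex_Re_le_cmod[of "P p * E' p"] by (intro mult_left_mono) (auto simp: norm_mult)
  ultimately have "(cmod (P p))\<^sup>2 - (1 - \<alpha>/2) * \<gamma> / q * (cmod (P p) * cmod (E' p)) \<le> k"
    using \<open>Re B \<le> k\<close> by linarith
  define T where "T = cmod (w' p)"
  \<comment> \<open>\<open>t\<^sup>2\<close> is the share of
    \<open>\<kappa>\<^sup>2 |w p|\<^sup>2\<close> in \<open>q\<close>; positivity of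
    \<open>m\<close> means \<open>t < 1\<close>. All quantities at \<open>p\<close> become functions
    of \<open>t\<close>, \<open>s\<close> and \<open>T\<close>, and then \<open>s\<close> and
    \<open>T\<close> cancel.\<close>
  define t where "t = \<kappa> * cmod (w p) / s"
  have T: "T > 0" using w'p by (simp add: T_def)
  have t0: "t \<ge> 0" using \<kappa> s by (simp add: t_def)
  have wp: "\<kappa> * cmod (w p) = t * s" using s by (simp add: t_def)
  have mt: "m = s\<^sup>2 * (1 - t\<^sup>2)"
    using arg_cong[OF wp, of "\<lambda>x. x\<^sup>2"] s(2) by (simp add: q_def power_mult_distrib algebra_simps)
  then have "1 - t\<^sup>2 > 0" using m s by (simp add: zero_less_mult_iff)
  then have t1: "t < 1" using t0 by (simp add: power2_less_1_iff abs_square_less_1)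
  have E'a: "cmod (E' p) = \<kappa> * t * s * T"
    using \<kappa> wp by (simp add: E'_def norm_mult T_def power2_eq_square)
  have "T\<^sup>2 / s\<^sup>2 * (1 - (1 - \<alpha>/2) * \<gamma> * \<kappa> * t) \<le> T\<^sup>2 / s\<^sup>2 * (\<gamma> * \<kappa>\<^sup>2 * (1 - t\<^sup>2) / 2)"
  proof -
    have "T\<^sup>2 / s\<^sup>2 * (1 - (1 - \<alpha>/2) * \<gamma> * \<kappa> * t)
        = (cmod (P p))\<^sup>2 - (1 - \<alpha>/2) * \<gamma> / q * (cmod (P p) * cmod (E' p))"
      unfolding Pabs E'a T_def[symmetric] s(2) using s(1)
      by (simp add: field_simps power2_eq_square)
    also have "\<dots> \<le> k" by fact
    also have "k = T\<^sup>2 / s\<^sup>2 * (\<gamma> * \<kappa>\<^sup>2 * (1 - t\<^sup>2) / 2)"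
      unfolding k_def T_def[symmetric] s(2) mt using s(1)
      by (simp add: field_simps power2_eq_square)
    finally show ?thesis .
  qed
  then have "1 - (1 - \<alpha>/2) * \<gamma> * \<kappa> * t \<le> \<gamma> * \<kappa>\<^sup>2 * (1 - t\<^sup>2) / 2"
    using T s by (subst (asm) mult_le_cancel_left_pos) auto
  then have "2 - (2 - \<alpha>) * \<gamma> * \<kappa> * t \<le> \<gamma> * \<kappa>\<^sup>2 * (1 - t\<^sup>2)"
    by (simp add: field_simps)
  then have "(1 - \<alpha>) * (2 - (2 - \<alpha>) * \<gamma> * \<kappa> * t) \<le> (1 - \<alpha>) * (\<gamma> * \<kappa>\<^sup>2 * (1 - t\<^sup>2))"
    using \<alpha> by (intro mult_left_mono) auto
  also have "\<dots> = ((1 - \<alpha>) * \<gamma>) * \<kappa>\<^sup>2 * (1 - t\<^sup>2)"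
    by (simp only: mult_ac)
  also have "(1 - \<alpha>) * (2 - (2 - \<alpha>) * \<gamma> * \<kappa> * t) = 2 * (1 - \<alpha>) - ((1 - \<alpha>) * \<gamma>) * (2 - \<alpha>) * \<kappa> * t"
    by algebra
  finally have fin: "2 * (1 - \<alpha>) - (2 - \<alpha>) * \<kappa> * t \<le> \<kappa>\<^sup>2 * (1 - t\<^sup>2)"
    by (simp add: \<gamma>)
  \<comment> \<open>With the hypothesis on \<kappa>, both sides of \<open>fin\<close> acquire the
    positive factor \<open>1 - t\<close>, which cancels.\<close>
  have "(2 - \<alpha>) * \<kappa> * t \<le> 2 * (1 - \<alpha>) * t"
    using \<kappa> t0 by (intro mult_right_mono) auto
  then have "(1 - t) * (2 * (1 - \<alpha>)) \<le> (1 - t) * (\<kappa>\<^sup>2 * (1 + t))"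
    using fin by (simp add: algebra_simps power2_eq_square)
  then have 1: "2 * (1 - \<alpha>) \<le> \<kappa>\<^sup>2 * (1 + t)"
    using t1 by simp
  have 2: "\<kappa>\<^sup>2 * (1 + t) < \<kappa>\<^sup>2 * 2"
    using t1 \<kappa> by simp
  \<comment> \<open>Since \<open>(2 - \<alpha>)\<^sup>2 - 4 * (1 - \<alpha>) =
    \<alpha>\<^sup>2\<close>, the hypothesis on \<kappa> yields
    \<open>\<kappa>\<^sup>2 \<le> 1 - \<alpha>\<close>, against the strict lower bound
    \<open>1 - \<alpha> < \<kappa>\<^sup>2\<close> implied by \<open>1\<close> and
    \<open>2\<close>.\<close>
  have "((2 - \<alpha>) * \<kappa>)\<^sup>2 \<le> (2 * (1 - \<alpha>))\<^sup>2"
    using \<kappa> \<alpha> by (intro power_mono) auto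
  also have "\<dots> \<le> (1 - \<alpha>) * (2 - \<alpha>)\<^sup>2"
  proof -
    have "(1 - \<alpha>) * (4 * (1 - \<alpha>)) \<le> (1 - \<alpha>) * (2 - \<alpha>)\<^sup>2"
      using \<alpha> by (intro mult_left_mono) (auto simp: power2_eq_square algebra_simps)
    then show ?thesis by (simp add: power2_eq_square algebra_simps)
  qed
  finally have "\<kappa>\<^sup>2 \<le> 1 - \<alpha>"
    using \<alpha> by (simp add: power_mult_distrib mult.commute)
  with 1 2 show False by simp
qed

subsection \<open>Schwarz--Pick estimates and a disk of Landau type\<close>

text \<open>The Schwarz lemma bounds the derivative at \<open>0\<close> of
  \<open>N \<circ> G \<circ> M\<close>, where the disk automorphism \<open>M\<close> takes
  \<open>0\<close> to \<zeta> and \<open>N\<close> takes \<open>G \<zeta>\<close> to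
  \<open>0\<close>; the chain rule supplies the two factors.\<close>

lemma Schwarz_Pick_deriv:
  assumes hol: "G holomorphic_on ball 0 1"
    and no: "\<And>z. cmod z < 1 \<Longrightarrow> cmod (G z) < 1" and \<zeta>: "cmod \<zeta> < 1"
  shows "cmod (deriv G \<zeta>) * (1 - (cmod \<zeta>)\<^sup>2) \<le> 1 - (cmod (G \<zeta>))\<^sup>2"
proof -
  define c where "c = G \<zeta>"
  have c: "cmod c < 1" using no \<zeta> by (simp add: c_def)
  define M where "M = Moebius_function 0 (-\<zeta>)"
  define N where "N = Moebius_function 0 c"
  have holM: "M holomorphic_on ball 0 1" and holN: "N holomorphic_on ball 0 1"
    using \<zeta> c by (auto simp: M_def N_def intro!: Moebius_function_holomorphic)
  have M1: "cmod (M z) < 1" if "cmod z < 1" for z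
    using Moebius_function_norm_lt_1[of "-\<zeta>" z 0] that \<zeta> by (simp add: M_def)
  have N1: "cmod (N z) < 1" if "cmod z < 1" for z
    using Moebius_function_norm_lt_1[of c z 0] that c by (simp add: N_def)
  have M0: "M 0 = \<zeta>" by (simp add: M_def Moebius_function_of_zero)
  define f where "f = N \<circ> G \<circ> M"
  have "f holomorphic_on ball 0 1"
    unfolding f_def
    by (rule holomorphic_on_compose_gen[OF holM holomorphic_on_compose_gen[OF hol holN]])
       (use M1 no in auto)
  moreover have "f 0 = 0"
    by (simp add: f_def M0 N_def c_def Moebius_function_eq_zero)
  moreover have "cmod (f z) < 1" if "cmod z < 1" for z
    using that N1 no M1 by (simp add: f_def)
  ultimately have "cmod (deriv f 0) \<le> 1"
    by (rule Schwarz_Lemma(2)[where \<xi> = 0]) auto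
  moreover have "(f has_field_derivative inverse (1 - cnj c * c) * (deriv G \<zeta> * (1 - \<zeta> * cnj \<zeta>))) (at 0)"
    unfolding f_def comp_assoc
  proof (rule DERIV_chain)
    have "(M has_field_derivative 1 - \<zeta> * cnj \<zeta>) (at 0)"
      unfolding M_def Moebius_function_simple by (auto intro!: derivative_eq_intros)
    moreover have "(G has_field_derivative deriv G \<zeta>) (at (M 0))"
      using holomorphic_derivI[OF hol open_ball] \<zeta> by (simp add: M0)
    ultimately show "(G \<circ> M has_field_derivative deriv G \<zeta> * (1 - \<zeta> * cnj \<zeta>)) (at 0)"
      by (rule DERIV_chain[rotated])
    have nz: "1 - cnj c * c \<noteq> 0"
      using norm_mult_less[of "cnj c" 1 c 1] c by auto
    have "((\<lambda>z. (z - c) / (1 - cnj c * z)) has_field_derivative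
        (1 * (1 - cnj c * c) - (c - c) * (- cnj c)) / ((1 - cnj c * c) * (1 - cnj c * c))) (at c)"
      by (rule DERIV_divide) (use nz in \<open>auto intro!: derivative_eq_intros\<close>)
    then have "((\<lambda>z. (z - c) / (1 - cnj c * z)) has_field_derivative inverse (1 - cnj c * c)) (at c)"
      using nz by (simp add: inverse_eq_divide)
    moreover have "N = (\<lambda>z. (z - c) / (1 - cnj c * z))"
      by (auto simp: N_def Moebius_function_simple)
    ultimately show "(N has_field_derivative inverse (1 - cnj c * c)) (at ((G \<circ> M) 0))"
      by (simp only: M0 c_def[symmetric] o_apply)
  qed
  ultimately have "cmod (inverse (1 - cnj c * c) * (deriv G \<zeta> * (1 - \<zeta> * cnj \<zeta>))) \<le> 1"
    by (simp add: DERIV_imp_deriv)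
  moreover have sq: "cmod (1 - z * cnj z) = 1 - (cmod z)\<^sup>2" if "cmod z < 1" for z
  proof -
    have "1 - z * cnj z = of_real (1 - (cmod z)\<^sup>2)"
      by (simp add: complex_norm_square[symmetric])
    moreover have "(cmod z)\<^sup>2 < 1" using that by (simp add: power_less_one_iff)
    ultimately show ?thesis by (simp only: norm_of_real)
  qed
  moreover have "(cmod c)\<^sup>2 < 1" using c by (simp add: power_less_one_iff)
  moreover have "cmod (inverse (1 - cnj c * c) * (deriv G \<zeta> * (1 - \<zeta> * cnj \<zeta>)))
      = inverse (1 - (cmod c)\<^sup>2) * (cmod (deriv G \<zeta>) * (1 - (cmod \<zeta>)\<^sup>2))"
    by (simp only: norm_mult norm_inverse sq[OF \<zeta>] sq[OF c] mult.commute[of "cnj c" c])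
  ultimately show ?thesis
    by (simp add: c_def[symmetric] inverse_eq_divide divide_le_eq)
qed

text \<open>The Schwarz lemma for \<open>N \<circ> G\<close> bounds the pseudohyperbolic distance of
  \<open>G 0\<close> and \<open>G \<zeta>\<close> by \<open>|\<zeta>|\<close>. After squaring, the
  only term that is not a function of moduli is \<open>Re (cnj c * u)\<close>, which is at most
  \<open>|c| |u|\<close>. The result serves as a lower bound for \<open>|G \<zeta>|\<close>.\<close>

lemma Schwarz_Pick_from_zero:
  assumes hol: "G holomorphic_on ball 0 1"
    and no: "\<And>z. cmod z < 1 \<Longrightarrow> cmod (G z) < 1" and \<zeta>: "cmod \<zeta> < 1"
  shows "cmod (G 0) - cmod (G \<zeta>) \<le> cmod \<zeta> * (1 - cmod (G 0) * cmod (G \<zeta>))"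
proof -
  define c where "c = G 0"
  define u where "u = G \<zeta>"
  have c: "cmod c < 1" and u: "cmod u < 1" using no \<zeta> by (simp_all add: c_def u_def)
  define N where "N = Moebius_function 0 c"
  have holN: "N holomorphic_on ball 0 1"
    using c by (auto simp: N_def intro!: Moebius_function_holomorphic)
  have N1: "cmod (N z) < 1" if "cmod z < 1" for z
    using Moebius_function_norm_lt_1[of c z 0] that c by (simp add: N_def)
  have "cmod ((N \<circ> G) \<zeta>) \<le> cmod \<zeta>"
  proof (rule Schwarz_Lemma(1))
    show "N \<circ> G holomorphic_on ball 0 1"
      by (rule holomorphic_on_compose_gen[OF hol holN]) (use no in auto)
  qed (use N1 no \<zeta> in \<open>auto simp: N_def c_def Moebius_function_eq_zero\<close>)
  then have "cmod (u - c) / cmod (1 - cnj c * u) \<le> cmod \<zeta>"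
    by (simp add: N_def Moebius_function_simple u_def norm_divide)
  moreover have "cmod (cnj c * u) < 1"
    using norm_mult_less[of "cnj c" 1 u 1] c u by simp
  then have "1 - cnj c * u \<noteq> 0" by auto
  ultimately have "cmod (u - c) \<le> cmod \<zeta> * cmod (1 - cnj c * u)"
    by (simp add: divide_le_eq)
  then have "(cmod (u - c))\<^sup>2 \<le> (cmod \<zeta> * cmod (1 - cnj c * u))\<^sup>2"
    by (intro power_mono) auto
  moreover define R where "R = Re (cnj c * u)"
  have uc: "(cmod (u - c))\<^sup>2 = (cmod u)\<^sup>2 + (cmod c)\<^sup>2 - 2 * R"
    unfolding cmod_power2 R_def by (simp add: power2_eq_square algebra_simps)
  have cu: "(cmod (1 - cnj c * u))\<^sup>2 = 1 + (cmod c)\<^sup>2 * (cmod u)\<^sup>2 - 2 * R"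
    unfolding cmod_power2 R_def by (simp add: power2_eq_square algebra_simps)
  ultimately have "(cmod u)\<^sup>2 + (cmod c)\<^sup>2 - (cmod \<zeta>)\<^sup>2 * (1 + (cmod c)\<^sup>2 * (cmod u)\<^sup>2)
      \<le> (1 - (cmod \<zeta>)\<^sup>2) * (2 * R)"
    unfolding power_mult_distrib uc cu by (simp add: algebra_simps)
  also have "\<dots> \<le> (1 - (cmod \<zeta>)\<^sup>2) * (2 * (cmod c * cmod u))"
    using \<zeta> complex_Re_le_cmod[of "cnj c * u"]
    by (intro mult_left_mono) (auto simp: R_def norm_mult power_le_one_iff simp del: times_complex.sel)
  finally have "(cmod c - cmod u)\<^sup>2 \<le> (cmod \<zeta> * (1 - cmod c * cmod u))\<^sup>2"
    by (simp add: power2_eq_square algebra_simps)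
  then have "cmod c - cmod u \<le> cmod \<zeta> * (1 - cmod c * cmod u)"
  proof (rule power2_le_imp_le)
    have "cmod c * cmod u \<le> 1 * 1" using c u by (intro mult_mono) auto
    then show "0 \<le> cmod \<zeta> * (1 - cmod c * cmod u)" by simp
  qed
  then show ?thesis by (simp add: c_def u_def)
qed

text \<open>Writing \<open>w z = z * k z\<close> and rescaling \<open>k\<close> gives a self-map
  \<open>G\<close> of the unit disk with \<open>|G 0| = a\<close>, and
  \<open>Schwarz_Pick_from_zero\<close> keeps \<open>|G|\<close> from being small. At a zero of
  \<open>deriv w\<close>, \<open>Schwarz_Pick_deriv\<close> would make \<open>|G|\<close> too small;
  on the circle the lower bound for \<open>|G|\<close> gives the one for \<open>|w|\<close>. Both
  arguments have the same threshold, \<open>a = 2 * sqrt 2 / 3\<close> at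
  \<open>|\<zeta>| = 1 / sqrt 2\<close>, whence the constant in the hypothesis on
  \<open>r\<close>.\<close>

lemma Landau_disc:
  assumes hol: "w holomorphic_on ball 0 r" and w0: "w 0 = 0" and dw: "deriv w 0 = 1"
    and bd: "\<And>z. cmod z < r \<Longrightarrow> cmod (w z) < 2" and r: "r > 4 * sqrt 2 / 3"
  obtains \<rho> where "0 < \<rho>" "\<rho> < r" "\<And>z. cmod z < \<rho> \<Longrightarrow> deriv w z \<noteq> 0"
    "\<And>z. cmod z = \<rho> \<Longrightarrow> 1 \<le> cmod (w z)"
proof -
  \<comment> \<open>Scaling by \<open>r' < r\<close> makes \<open>|G|\<close> strictly less than 1,
    since \<open>|k|\<close> is at most \<open>2 / r\<close>.\<close>
  obtain r' where r': "4 * sqrt 2 / 3 < r'" "r' < r" using r dense by blast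
  have sqp: "sqrt 2 > 0" "sqrt 2 * sqrt 2 = 2" by auto
  have "0 < 4 * sqrt 2 / 3" by simp
  then have r0: "0 < r'" "0 < r" using r' by linarith+
  obtain k where holk: "k holomorphic_on ball 0 r" and k: "\<And>z. cmod z < r \<Longrightarrow> w z = z * k z"
    and k0: "deriv w 0 = k 0"
    using Schwarz3[OF hol w0] by blast
  define f where "f = (\<lambda>z. w (of_real r * z) / 2)"
  have scale: "cmod (of_real r * z) < r" if "cmod z < 1" for z
    using that r0 by (simp add: norm_mult)
  have holf: "f holomorphic_on ball 0 1"
    unfolding f_def
    by (intro holomorphic_intros holomorphic_on_compose_gen[OF _ hol, unfolded o_def])
       (use scale in auto)
  have f1: "cmod (f z) < 1" if "cmod z < 1" for z
    using bd[OF scale[OF that]] by (simp add: f_def norm_divide)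
  have kbd: "cmod (k z) \<le> 2 / r" if z: "cmod z < r" for z
  proof (cases "z = 0")
    case False
    have "cmod (f (z / of_real r)) \<le> cmod (z / of_real r)"
      using Schwarz_Lemma(1)[OF holf _ f1, of "z / of_real r"] z r0 w0 by (simp add: f_def norm_divide)
    then show ?thesis
      using False r0 k[OF z] by (simp add: f_def norm_divide norm_mult field_simps)
  next
    case True
    have "cmod (deriv f 0) \<le> 1"
      using Schwarz_Lemma(2)[OF holf _ f1, of 0] w0 by (simp add: f_def)
    moreover have "(w has_field_derivative 1) (at (of_real r * 0))"
      using holomorphic_derivI[OF hol open_ball, of 0] r0 dw by simp
    then have "((\<lambda>z. w (of_real r * z)) has_field_derivative 1 * of_real r) (at 0)"
      by (rule DERIV_chain2) (auto intro!: derivative_eq_intros)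
    then have "(f has_field_derivative of_real r / 2) (at 0)"
      unfolding f_def by (auto intro!: derivative_eq_intros)
    ultimately show ?thesis
      using r0 True k0 dw by (simp add: DERIV_imp_deriv norm_divide)
  qed
  define G where "G = (\<lambda>z. of_real (r'/2) * k (of_real r' * z))"
  have scale': "cmod (of_real r' * z) < r" if "cmod z \<le> 1" for z
  proof -
    have "r' * cmod z \<le> r' * 1" using that r0 by (intro mult_left_mono) auto
    moreover have "cmod (of_real r' * z) = r' * cmod z" using r0 by (simp add: norm_mult)
    ultimately show ?thesis using r' by linarith
  qed
  have holG: "G holomorphic_on ball 0 1"
    unfolding G_def
    by (intro holomorphic_intros holomorphic_on_compose_gen[OF _ holk, unfolded o_def])
       (use scale' in auto)
  have G1: "cmod (G z) < 1" if "cmod z < 1" for z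
  proof -
    have "cmod (G z) \<le> r'/2 * (2 / r)"
      unfolding G_def norm_mult using r0 that
      by (intro mult_mono kbd scale') auto
    also have "\<dots> < 1" using r0 r' by simp
    finally show ?thesis .
  qed
  define a where "a = r' / 2"
  have a: "2 * sqrt 2 / 3 < a" "a < 1" and G0: "cmod (G 0) = a"
    using r' r0 G1[of 0] k0 dw by (auto simp: a_def G_def)
  have SP: "a - cmod (G z) \<le> cmod z * (1 - a * cmod (G z))" if "cmod z < 1" for z
    using Schwarz_Pick_from_zero[OF holG G1 that] G0 by simp
  have sqrt2: "1 / sqrt 2 < 1" by simp
  \<comment> \<open>In the variable \<open>\<zeta> = z / r'\<close> this is the circle of radius
    \<open>1 / sqrt 2\<close>.\<close>
  define \<rho> where "\<rho> = r' / sqrt 2"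
  have "0 < \<rho>" using r0 by (simp add: \<rho>_def)
  moreover have "\<rho> < r" 
  proof -
    have "\<rho> < r'" unfolding \<rho>_def using r0 by (simp add: divide_less_eq)
    then show ?thesis using r' by simp
  qed
  moreover have "deriv w z \<noteq> 0" if z: "cmod z < \<rho>" for z
  proof
    assume d0: "deriv w z = 0"
    have zr: "cmod z < r" using z \<open>\<rho> < r\<close> by simp
    define \<zeta> where "\<zeta> = z / of_real r'"
    define t where "t = cmod \<zeta>"
    define x where "x = cmod (G \<zeta>)"
    have z\<zeta>: "z = of_real r' * \<zeta>" using r0 by (simp add: \<zeta>_def)
    have t: "t < 1 / sqrt 2" "0 \<le> t"
      using z r0 by (auto simp: t_def \<zeta>_def \<rho>_def norm_divide field_simps)
    have t1: "cmod \<zeta> < 1" using t sqrt2 unfolding t_def by linarith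
    have kd: "(k has_field_derivative deriv k z) (at z)"
      using holomorphic_derivI[OF holk open_ball, of z] zr by simp
    have "((\<lambda>z. z * k z) has_field_derivative k z + z * deriv k z) (at z)"
      using kd by (auto intro!: derivative_eq_intros)
    then have "(w has_field_derivative k z + z * deriv k z) (at z)"
      by (rule has_field_derivative_transform_within_open[where S = "ball 0 r"]) (use zr k in auto)
    \<comment> \<open>At a critical point of \<open>w\<close> the product rule relates
      \<open>k\<close> to its derivative; after rescaling, \<open>|G \<zeta>|\<close> is
      \<open>|\<zeta>|\<close> times the modulus of \<open>deriv G \<zeta>\<close>, and Schwarz-Pick
      then forces \<open>x \<le> t\<close>.\<close>
    then have kz: "k z = - (z * deriv k z)"
      using d0 by (simp add: DERIV_imp_deriv eq_neg_iff_add_eq_0)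
    have "((\<lambda>u. k (of_real r' * u)) has_field_derivative deriv k z * of_real r') (at \<zeta>)"
      by (rule DERIV_chain2[where f = k and g = "\<lambda>u. of_real r' * u"])
        (use kd z\<zeta> in \<open>auto intro!: derivative_eq_intros\<close>)
    then have "(G has_field_derivative of_real (r'/2) * (deriv k z * of_real r')) (at \<zeta>)"
      unfolding G_def by (rule DERIV_cmult)
    then have "G \<zeta> = - (\<zeta> * deriv G \<zeta>)"
      using kz z\<zeta> by (simp add: DERIV_imp_deriv G_def)
    then have x: "x = t * cmod (deriv G \<zeta>)"
      by (simp add: x_def t_def norm_mult)
    have "t * (cmod (deriv G \<zeta>) * (1 - t\<^sup>2)) \<le> t * (1 - x\<^sup>2)"
      using Schwarz_Pick_deriv[OF holG G1 t1] t by (intro mult_left_mono) (auto simp: t_def x_def)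
    then have "x * (1 - t\<^sup>2) \<le> t * (1 - x\<^sup>2)"
      by (simp add: x mult_ac)
    then have "(x - t) * (1 + t * x) \<le> 0"
      by (simp add: power2_eq_square algebra_simps)
    moreover have "1 + t * x > 0" using t by (simp add: x_def add_pos_nonneg)
    ultimately have "x \<le> t" by (simp add: mult_le_0_iff)
    have at: "a * t \<le> 1"
      using a t t1 sqp by (intro mult_le_one) (auto simp: t_def)
    have "a - t \<le> x * (1 - a * t)"
      using SP[OF t1] by (simp add: x_def t_def algebra_simps)
    also have "\<dots> \<le> t * (1 - a * t)"
      using \<open>x \<le> t\<close> at by (intro mult_right_mono) auto
    finally have "a * (1 + t\<^sup>2) \<le> 2 * t"
      by (simp add: power2_eq_square algebra_simps)
    moreover have "2 * sqrt 2 / 3 * (1 + t\<^sup>2) < a * (1 + t\<^sup>2)"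
      using a by (intro mult_strict_right_mono) (auto simp: add_pos_nonneg)
    \<comment> \<open>The product equals \<open>sqrt 2 * (1 + t\<^sup>2) - 3 * t\<close>, so its
      sign says that \<open>2 * t\<close> is at most
      \<open>2 * sqrt 2 / 3 * (1 + t\<^sup>2)\<close>.\<close>
    moreover have "(1 - sqrt 2 * t) * (sqrt 2 - t) \<ge> 0"
    proof (rule mult_nonneg_nonneg)
      show "0 \<le> 1 - sqrt 2 * t" using t by (simp add: field_simps)
      have "1 < sqrt 2" by simp
      then show "0 \<le> sqrt 2 - t" using t1 unfolding t_def by linarith
    qed
    ultimately show False
      using sqp by (simp add: algebra_simps power2_eq_square)
  qed
  moreover have "1 \<le> cmod (w z)" if z: "cmod z = \<rho>" for z
  proof (rule ccontr)
    assume not: "\<not> 1 \<le> cmod (w z)"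
    have zr: "cmod z < r" using z \<open>\<rho> < r\<close> by simp
    define \<zeta> where "\<zeta> = z / of_real r'"
    have z\<zeta>: "z = of_real r' * \<zeta>" using r0 by (simp add: \<zeta>_def)
    have t: "cmod \<zeta> = 1 / sqrt 2"
      using z r0 by (auto simp: \<zeta>_def \<rho>_def norm_divide)
    define x where "x = cmod (G \<zeta>)"
    have "cmod (w z) = sqrt 2 * x"
    proof -
      have "cmod (w z) = 2 * cmod \<zeta> * x"
        using k[OF zr] r0 by (simp add: x_def G_def z\<zeta> norm_mult)
      also have "\<dots> = sqrt 2 * x"
        using sqp by (simp add: t field_simps)
      finally show ?thesis .
    qed
    then have x: "sqrt 2 * x < 1" using not by simp
    have "a - x \<le> 1 / sqrt 2 * (1 - a * x)"
      using SP[of \<zeta>] t sqrt2 by (simp add: x_def)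
    then have "sqrt 2 * (a - x) \<le> sqrt 2 * (1 / sqrt 2 * (1 - a * x))"
      by (intro mult_left_mono) auto
    also have "sqrt 2 * (1 / sqrt 2 * (1 - a * x)) = 1 - a * x" by simp
    finally have "sqrt 2 * a - 1 \<le> x * (sqrt 2 - a)"
      by (simp add: algebra_simps)
    then have "sqrt 2 * (sqrt 2 * a - 1) \<le> sqrt 2 * (x * (sqrt 2 - a))"
      by (intro mult_left_mono) auto
    also have "\<dots> = (sqrt 2 * x) * (sqrt 2 - a)" by simp
    also have "\<dots> \<le> 1 * (sqrt 2 - a)"
    proof (intro mult_right_mono)
      have "1 < sqrt 2" by simp
      then show "0 \<le> sqrt 2 - a" using a by linarith
    qed (use x in auto)
    finally have "3 * a \<le> 2 * sqrt 2"
      using sqp by (simp add: algebra_simps)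
    then show False using a by simp
  qed
  ultimately show thesis using that by blast
qed

subsection \<open>Existence of a disk\<close>

text \<open>Separation of variables: the elapsed time \<open>T\<close> is an antiderivative of
  \<open>1 / F\<close>, strictly increasing since \<open>F\<close> is positive, and the solution is
  its inverse. Continuity of \<open>F\<close> suffices, without a Lipschitz condition.\<close>

lemma local_solution_autonomous:
  fixes F :: "real \<Rightarrow> real"
  assumes cont: "continuous_on UNIV F" and pos: "\<And>s. F s > 0"
  obtains s d where "d > 0" "s 0 = 0" "\<And>y. \<bar>y\<bar> < d \<Longrightarrow> (s has_real_derivative F (s y)) (at y)"
proof -
  have "continuous_on {-1..1} (\<lambda>s. inverse (F s))"
    using pos by (intro continuous_intros continuous_on_subset[OF cont]) (auto simp: less_imp_neq[symmetric])
  then obtain T0 where T0: "\<And>x. x \<in> {-1..1} \<Longrightarrow> (T0 has_vector_derivative inverse (F x)) (at x within {-1..1})"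
    using antiderivative_continuous by metis
  define T where "T = (\<lambda>x. T0 x - T0 0)"
  have Tw: "(T has_real_derivative inverse (F x)) (at x within {-1..1})" if "x \<in> {-1..1}" for x
    unfolding T_def has_real_derivative_iff_has_vector_derivative
    using T0[OF that] by (auto intro!: derivative_eq_intros)
  have Td: "(T has_real_derivative inverse (F x)) (at x)" if "x \<in> {-1<..<1}" for x
    using Tw[of x] that at_within_interior[of x "{-1..1::real}"] by auto
  have contT: "continuous_on {-1..1} T"
    using Tw by (rule DERIV_continuous_on)
  have mono: "T x < T y" if "-1 \<le> x" "x < y" "y \<le> 1" for x y
  proof (rule DERIV_pos_imp_increasing_open[OF \<open>x < y\<close>])
    show "\<exists>D. (T has_real_derivative D) (at u) \<and> 0 < D" if "x < u" "u < y" for u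
      using Td[of u] that \<open>-1 \<le> x\<close> \<open>y \<le> 1\<close> pos[of u] by (intro exI[of _ "inverse (F u)"]) auto
    show "continuous_on {x..y} T" using contT that by (auto intro: continuous_on_subset)
  qed
  have inj: "inj_on T {-1..1}"
    by (intro linorder_inj_onI') (use mono in force)
  define s where "s = inv_into {-1..1} T"
  have Ts: "T (s y) = y \<and> s y \<in> {-1<..<1}" if y: "T (-1) < y" "y < T 1" for y
  proof -
    obtain x where x: "-1 \<le> x" "x \<le> 1" "T x = y"
      using IVT'[of T "-1" y 1] y contT by auto
    then have "s y = x" using inj by (auto simp: s_def)
    moreover have "x \<noteq> -1" "x \<noteq> 1" using x y by auto
    ultimately show ?thesis using x by auto
  qed
  have sT: "s (T x) = x" if "x \<in> {-1..1}" for x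
    using inj that by (simp add: s_def)
  have T00: "T 0 = 0" by (simp add: T_def)
  have s0: "s 0 = 0" using sT[of 0] T00 by simp
  have ends: "T (-1) < 0" "0 < T 1" using mono[of "-1" 0] mono[of 0 1] T00 by auto
  have sd: "(s has_real_derivative F (s y)) (at y)" if y: "T (-1) < y" "y < T 1" for y
  proof -
    have sy: "s y \<in> {-1<..<1}" "T (s y) = y" using Ts[OF y] by auto
    define e where "e = min (1 - s y) (s y + 1) / 2"
    have e: "e > 0" "e \<le> (1 - s y) / 2" "e \<le> (s y + 1) / 2"
      using sy by (auto simp: e_def)
    have "isCont s (T (s y))"
    proof (rule isCont_inverse_function[where f = T and x = "s y", OF e(1)])
      fix z assume "\<bar>z - s y\<bar> \<le> e"
      then have "z \<in> {-1<..<1}" using e sy by (auto simp: abs_le_iff)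
      then show "s (T z) = z" "isCont T z" using sT[of z] DERIV_isCont[OF Td[of z]] by auto
    qed
    then have "isCont s y" using sy by simp
    then have "(s has_real_derivative inverse (inverse (F (s y)))) (at y)"
    proof (rule DERIV_inverse_function[where f = T and a = "T (-1)" and b = "T 1", rotated -1])
      show "inverse (F (s y)) \<noteq> 0" using pos[of "s y"] by simp
      show "T (s u) = u" if "T (-1) < u" "u < T 1" for u using Ts[OF that] by simp
    qed (use Td[OF sy(1)] y in auto)
    then show ?thesis by simp
  qed
  define d where "d = min (- T (-1)) (T 1)"
  have "d > 0" using ends by (simp add: d_def)
  moreover have "(s has_real_derivative F (s y)) (at y)" if "\<bar>y\<bar> < d" for y
    using that by (intro sd) (auto simp: d_def)
  ultimately show thesis using that s0 by blast
qed

text \<open>The unknown moves on the line \<open>b - 2 \<i> s\<close>, so the equation is a scalar autonomous one for \<open>s\<close>;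
  the maximum in the proof only keeps its right-hand side away from zero globally.\<close>

lemma local_solution_power_field:
  fixes b :: complex
  assumes "b \<noteq> 0"
  obtains H d where "d > 0" "H 0 = b"
    "\<And>y. \<bar>y\<bar> < d \<Longrightarrow> (H has_vector_derivative - 2 * \<i> * of_real (cmod (H y) powr \<alpha>)) (at y)"
proof -
  define F where "F = (\<lambda>s. max (cmod (b - 2 * \<i> * of_real s)) (cmod b / 2) powr \<alpha>)"
  have mp: "max x (cmod b / 2) > 0" for x using assms by (simp add: less_max_iff_disj)
  have "continuous_on UNIV F"
    unfolding F_def by (intro continuous_intros ballI less_imp_neq[OF mp, THEN not_sym])
  moreover have "F s > 0" for s
    unfolding F_def using mp[of "cmod (b - 2 * \<i> * of_real s)"] by simp
  ultimately obtain s d where s: "d > 0" "s 0 = 0"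
    "\<And>y. \<bar>y\<bar> < d \<Longrightarrow> (s has_real_derivative F (s y)) (at y)"
    using local_solution_autonomous by metis
  define H where "H = (\<lambda>y. b - 2 * \<i> * of_real (s y))"
  have H0: "H 0 = b" by (simp add: H_def s)
  have "isCont s 0" using DERIV_isCont[OF s(3)[of 0]] s(1) by simp
  then have "isCont (\<lambda>y. cmod (H y)) 0"
    unfolding H_def by (intro continuous_intros) auto
  then have "((\<lambda>y. cmod (H y)) \<longlongrightarrow> cmod b) (at 0)"
    by (simp add: isCont_def H0)
  then have "eventually (\<lambda>y. cmod b / 2 < cmod (H y)) (at 0)"
    by (rule order_tendstoD) (use assms in auto)
  then obtain d1 where d1: "d1 > 0" "\<And>y. y \<noteq> 0 \<Longrightarrow> \<bar>y\<bar> < d1 \<Longrightarrow> cmod b / 2 < cmod (H y)"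
    unfolding eventually_at by auto
  have "(H has_vector_derivative - 2 * \<i> * of_real (cmod (H y) powr \<alpha>)) (at y)" if y: "\<bar>y\<bar> < min d d1" for y
  proof -
    \<comment> \<open>For small \<open>y\<close> the maximum in \<open>F\<close> is attained by its
      first argument, so \<open>F (s y)\<close> is the intended right-hand side.\<close>
    have "cmod b / 2 \<le> cmod (H y)"
      using d1(2)[of y] y by (cases "y = 0") (auto simp: H0)
    then have "F (s y) = cmod (H y) powr \<alpha>"
      by (simp add: F_def H_def max_absorb1)
    then have "(s has_vector_derivative cmod (H y) powr \<alpha>) (at y)"
      using s(3)[of y] y by (simp add: has_real_derivative_iff_has_vector_derivative)
    then have "((\<lambda>y. complex_of_real (s y)) has_vector_derivative of_real (cmod (H y) powr \<alpha>)) (at y)"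
      by (rule bounded_linear.has_vector_derivative[OF bounded_linear_of_real])
    then have "((\<lambda>y. b - 2 * \<i> * complex_of_real (s y)) has_vector_derivative
        0 - 2 * \<i> * of_real (cmod (H y) powr \<alpha>)) (at y)"
      by (intro has_vector_derivative_diff has_vector_derivative_const has_vector_derivative_mult_right)
    then show ?thesis by (simp add: H_def[symmetric])
  qed
  moreover have "min d d1 > 0" using s(1) d1(1) by simp
  ultimately show thesis using H0 by (rule that[rotated -1])
qed

section \<open>Complex coordinates on \<open>real ^ 4\<close>\<close>

lemma vector_4 [simp]:
  "(vector [a, b, c, d] :: 'a::zero ^ 4) $ 1 = a"
  "(vector [a, b, c, d] :: 'a::zero ^ 4) $ 2 = b"
  "(vector [a, b, c, d] :: 'a::zero ^ 4) $ 3 = c"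
  "(vector [a, b, c, d] :: 'a::zero ^ 4) $ 4 = d"
  by (simp_all add: vector_def)

lemma vec4_eq_iff: "x = y \<longleftrightarrow> zc1 x = zc1 y \<and> zc2 x = zc2 y"
  by (auto simp: vec_eq_iff forall_4 zc1_def zc2_def)

lemma zc_vec_of_C2 [simp]:
  "zc1 (vec_of_C2 a b) = a" "zc2 (vec_of_C2 a b) = b"
  by (simp_all add: zc1_def zc2_def vec_of_C2_def)

text \<open>In complex coordinates the condition of J-holomorphy splits into the Cauchy-Riemann
  equation for the first component and an inhomogeneous one for the second.\<close>

lemma zc_Jmat:
  "zc1 (Jmat lam x *v v) = \<i> * zc1 v"
  "zc2 (Jmat lam x *v v) = \<i> * zc2 v + \<i> * of_real (lam x) * cnj (zc1 v)"
  by (simp_all add: zc1_def zc2_def Jmat_def matrix_vector_mult_def sum_4 complex_eq_iff)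

lemma bounded_linear_zc: "bounded_linear zc1" "bounded_linear zc2"
  unfolding linear_conv_bounded_linear[symmetric]
  by (auto intro!: linearI simp: zc1_def zc2_def complex_eq_iff)

lemma bounded_linear_vec_of_C2: "bounded_linear (\<lambda>p. vec_of_C2 (fst p) (snd p))"
  unfolding linear_conv_bounded_linear[symmetric]
  by (auto intro!: linearI simp: vec4_eq_iff linear_add linear_cmul bounded_linear_zc[THEN bounded_linear.linear])

section \<open>Construction of one disk through the given point\<close>

text \<open>Needed because the infimum of the empty set of reals carries no information.\<close>

lemma exists_J_holomorphic_disk:
  assumes b: "b \<noteq> 0" "cmod b < S"
  shows "\<exists>r>0. \<exists>Z. J_holomorphic_disk S (\<lambda>x. - 2 * cmod (zc2 x) powr \<alpha>) r Z \<and>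
     Z 0 = vec_of_C2 0 b \<and> frechet_derivative Z (at 0) 1 = vec_of_C2 1 0"
proof -
  obtain H d where H: "d > 0" "H 0 = b"
    "\<And>y. \<bar>y\<bar> < d \<Longrightarrow> (H has_vector_derivative - 2 * \<i> * of_real (cmod (H y) powr \<alpha>)) (at y)"
    using local_solution_power_field[OF b(1)] by metis
  have contH: "isCont H y" if "\<bar>y\<bar> < d" for y
    using H(3)[OF that] by (rule has_vector_derivative_continuous)
  have "((\<lambda>y. cmod (H y)) \<longlongrightarrow> cmod (H 0)) (at 0)"
    using contH[of 0] H(1) by (intro tendsto_intros) (auto simp: isCont_def)
  then have "eventually (\<lambda>y. cmod (H y) < S) (at 0)"
    by (rule order_tendstoD) (use b H in auto)
  moreover have "((\<lambda>y. cmod (H y)) \<longlongrightarrow> cmod (H 0)) (at 0)"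
    using contH[of 0] H(1) by (intro tendsto_intros) (auto simp: isCont_def)
  then have "eventually (\<lambda>y. 0 < cmod (H y)) (at 0)"
    by (rule order_tendstoD) (use b H in auto)
  ultimately have "eventually (\<lambda>y. cmod (H y) < S \<and> 0 < cmod (H y)) (at 0)"
    by eventually_elim auto
  then obtain d1 where d1: "d1 > 0" "\<And>y. y \<noteq> 0 \<Longrightarrow> \<bar>y\<bar> < d1 \<Longrightarrow> cmod (H y) < S \<and> 0 < cmod (H y)"
    unfolding eventually_at by auto
  \<comment> \<open>The bound 2 keeps the first coordinate, which will be \<open>z\<close> itself,
    in its disk; the bound \<open>d1\<close> keeps \<open>H\<close> in \<open>Dsk S\<close> and away
    from zero, where the power is continuous.\<close>
  define r where "r = min (min d d1) 2"
  have r: "r > 0" "r \<le> d" "r \<le> d1" "r \<le> 2" using H d1 by (auto simp: r_def)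
  have HS: "cmod (H y) < S" "H y \<noteq> 0" if "\<bar>y\<bar> < r" for y
    using d1(2)[of y] that r b H by (cases "y = 0"; auto)+
  define c where "c = (\<lambda>z. - 2 * \<i> * complex_of_real (cmod (H (Im z)) powr \<alpha>))"
  \<comment> \<open>With first component \<open>z\<close> and second component depending on
    \<open>Im z\<close> only, the derivative in the conjugate variable is \<open>\<i> / 2\<close>
    times that of \<open>H\<close>, so the disk equation becomes the differential equation satisfied
    by \<open>H\<close>.\<close>
  define Z where "Z = (\<lambda>z. vec_of_C2 z (H (Im z)))"
  have Im_r: "\<bar>Im z\<bar> < r" if "z \<in> Dsk r" for z
    using that abs_Im_le_cmod[of z] by (simp add: Dsk_def)
  have Zd: "(Z has_derivative (\<lambda>v. vec_of_C2 v (of_real (Im v) * c z))) (at z)" if z: "z \<in> Dsk r" for z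
  proof -
    have "(H has_derivative (\<lambda>t. t *\<^sub>R c z)) (at (Im z))"
      using H(3)[of "Im z"] Im_r[OF z] r by (simp add: has_vector_derivative_def c_def)
    from has_derivative_compose[OF has_derivative_Im[OF has_derivative_ident] this]
    have "((\<lambda>z. (z, H (Im z))) has_derivative (\<lambda>v. (v, Im v *\<^sub>R c z))) (at z)"
      by (intro has_derivative_Pair has_derivative_ident)
    from bounded_linear.has_derivative[OF bounded_linear_vec_of_C2 this]
    show ?thesis by (simp add: Z_def scaleR_conv_of_real)
  qed
  have bl: "bounded_linear (\<lambda>v. vec_of_C2 (f v) (g v))" if "bounded_linear f" "bounded_linear g"
    for f g :: "complex \<Rightarrow> complex"
    using bounded_linear_compose[OF bounded_linear_vec_of_C2 bounded_linear_Pair[OF that]] by simp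
  have blI: "bounded_linear (\<lambda>v. complex_of_real (Im v) * x)" for x
    by (intro bounded_linear_mult_left[THEN bounded_linear_compose] bounded_linear_of_real[THEN bounded_linear_compose] bounded_linear_Im)
  \<comment> \<open>The derivative of \<open>Z\<close> is a real combination of three fixed linear
    maps, so its continuity reduces to that of the coefficient \<open>c\<close>.\<close>
  define B1 where "B1 = Blinfun (\<lambda>v. vec_of_C2 v 0)"
  define B2 where "B2 = Blinfun (\<lambda>v. vec_of_C2 0 (of_real (Im v) * 1))"
  define B3 where "B3 = Blinfun (\<lambda>v. vec_of_C2 0 (of_real (Im v) * \<i>))"
  have B: "blinfun_apply B1 v = vec_of_C2 v 0" "blinfun_apply B2 v = vec_of_C2 0 (of_real (Im v) * 1)"
     "blinfun_apply B3 v = vec_of_C2 0 (of_real (Im v) * \<i>)" for v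
    unfolding B1_def B2_def B3_def
    by (subst bounded_linear_Blinfun_apply; intro bl bounded_linear_ident bounded_linear_zero blI refl)+
  define Z' where "Z' = (\<lambda>z. B1 + Re (c z) *\<^sub>R B2 + Im (c z) *\<^sub>R B3)"
  have Z'eq: "blinfun_apply (Z' z) = (\<lambda>v. vec_of_C2 v (of_real (Im v) * c z))" for z
    by (auto simp: Z'_def plus_blinfun.rep_eq scaleR_blinfun.rep_eq B vec4_eq_iff
      linear_add linear_cmul bounded_linear_zc[THEN bounded_linear.linear] complex_eq_iff)
  have "C1_on Z (Dsk r)"
    unfolding C1_on_def
  proof (intro exI conjI ballI)
    show "(Z has_derivative blinfun_apply (Z' z)) (at z)" if "z \<in> Dsk r" for z
      using Zd[OF that] by (simp add: Z'eq)
    have "continuous_on {-r<..<r} H"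
      using contH r by (auto intro!: continuous_at_imp_continuous_on)
    moreover have "Im ` Dsk r \<subseteq> {-r<..<r}"
      using Im_r by (metis abs_less_iff greaterThanLessThan_iff image_subsetI minus_less_iff)
    ultimately have "continuous_on (Dsk r) (\<lambda>z. H (Im z))"
      by (intro continuous_on_compose2[of "{-r<..<r}" H "Dsk r" Im] continuous_on_Im continuous_on_id)
    then have "continuous_on (Dsk r) c"
      unfolding c_def using HS Im_r by (intro continuous_intros) auto
    then show "continuous_on (Dsk r) Z'"
      unfolding Z'_def by (intro continuous_intros)
  qed
  moreover have fd: "frechet_derivative Z (at z) = (\<lambda>v. vec_of_C2 v (of_real (Im v) * c z))" if "z \<in> Dsk r" for z
    using frechet_derivative_at[OF Zd[OF that]] by simp
  moreover have "Z ` Dsk r \<subseteq> Omega S"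
    using HS Im_r r by (auto simp: Z_def Omega_def Dsk_def)
  moreover have "frechet_derivative Z (at z) (\<i> * h) =
      Jmat (\<lambda>x. - 2 * cmod (zc2 x) powr \<alpha>) (Z z) *v frechet_derivative Z (at z) h" if "z \<in> Dsk r" for z h
    unfolding fd[OF that] by (simp add: vec4_eq_iff zc_Jmat c_def Z_def complex_eq_iff algebra_simps)
  ultimately have "J_holomorphic_disk S (\<lambda>x. - 2 * cmod (zc2 x) powr \<alpha>) r Z"
    by (simp add: J_holomorphic_disk_def)
  moreover have "frechet_derivative Z (at 0) 1 = vec_of_C2 1 0"
    using fd[of 0] r by (simp add: Dsk_def)
  moreover have "Z 0 = vec_of_C2 0 b" by (simp add: Z_def H)
  ultimately show ?thesis using r by blast
qed

subsection \<open>The bound on the radius\<close>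

text \<open>Otherwise \<phi>, which is positive at the centre, would be nonpositive on the boundary
  circle because \<open>|w|\<close> is at least 1 there. Its maximum over the closed disk would be
  positive and interior, which \<open>no_interior_contact\<close> excludes.\<close>

lemma max_principle_lower_bound:
  fixes h A w w' :: "complex \<Rightarrow> complex"
  assumes \<alpha>: "0 < \<alpha>" "\<alpha> < 1" and \<rho>: "0 < \<rho>" "\<rho> < r"
    and hd: "\<And>z. z \<in> ball 0 r \<Longrightarrow>
      (h has_derivative (\<lambda>v. A z * v + of_real (cmod (h z) powr \<alpha>) * cnj (w' z) * cnj v)) (at z)"
    and cA: "continuous_on (ball 0 r) A"
    and wd: "\<And>z. z \<in> ball 0 r \<Longrightarrow> (w has_field_derivative w' z) (at z)"
    and w0: "w 0 = 0" and w'nz: "\<And>z. z \<in> ball 0 \<rho> \<Longrightarrow> w' z \<noteq> 0"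
    and wbd: "\<And>z. cmod z = \<rho> \<Longrightarrow> 1 \<le> cmod (w z)"
    and \<kappa>: "0 < \<kappa>" "(2 - \<alpha>) * \<kappa> \<le> 2 * (1 - \<alpha>)" and h0: "h 0 \<noteq> 0"
  shows "\<exists>z\<in>sphere 0 \<rho>. \<kappa>\<^sup>2 < cmod (h z) powr (2 * (1 - \<alpha>))"
proof (rule ccontr)
  assume "\<not> (\<exists>z\<in>sphere 0 \<rho>. \<kappa>\<^sup>2 < cmod (h z) powr (2 * (1 - \<alpha>)))"
  then have hbd: "cmod (h z) powr (2 * (1 - \<alpha>)) \<le> \<kappa>\<^sup>2" if "cmod z = \<rho>" for z
    using that by (force simp: not_less)
  define \<phi> where "\<phi> = (\<lambda>z. cmod (h z) powr (2 * (1 - \<alpha>)) - \<kappa>\<^sup>2 * (cmod (w z))\<^sup>2)"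
  have sub: "cball 0 \<rho> \<subseteq> ball (0::complex) r" using \<rho> by auto
  have "isCont h z" "isCont w z" if "z \<in> ball 0 r" for z
    using has_derivative_continuous[OF hd[OF that]] DERIV_isCont[OF wd[OF that]] by auto
  then have "continuous_on (cball 0 \<rho>) h" "continuous_on (cball 0 \<rho>) w"
    using sub by (meson continuous_at_imp_continuous_on subsetD)+
  then have "continuous_on (cball 0 \<rho>) \<phi>"
    unfolding \<phi>_def using \<alpha> by (intro continuous_intros continuous_on_powr') auto
  then obtain p where p: "p \<in> cball 0 \<rho>" and pmax: "\<And>z. z \<in> cball 0 \<rho> \<Longrightarrow> \<phi> z \<le> \<phi> p"
    using continuous_attains_sup[of "cball 0 \<rho>" \<phi>] \<rho> by auto
  have "0 < \<phi> 0" using h0 w0 by (simp add: \<phi>_def)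
  also have "\<phi> 0 \<le> \<phi> p" using \<rho> by (intro pmax) auto
  finally have m: "0 < \<phi> p" .
  have "cmod p \<noteq> \<rho>"
  proof
    assume "cmod p = \<rho>"
    then have "cmod (h p) powr (2 * (1 - \<alpha>)) \<le> \<kappa>\<^sup>2" "1 \<le> (cmod (w p))\<^sup>2"
      using hbd wbd by (auto simp: one_le_power)
    moreover from this(2) have "\<kappa>\<^sup>2 * 1 \<le> \<kappa>\<^sup>2 * (cmod (w p))\<^sup>2"
      by (intro mult_left_mono) auto
    ultimately show False using m by (simp add: \<phi>_def)
  qed
  then have pb: "cmod p < \<rho>" using p by simp
  define e where "e = \<rho> - cmod p"
  have e: "e > 0" using pb by (simp add: e_def)
  have be: "ball p e \<subseteq> ball 0 \<rho>"
    unfolding e_def by (rule ball_subset_ball_iff[THEN iffD2]) (simp add: dist_norm)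
  then have sub2: "ball p e \<subseteq> ball 0 r" "ball p e \<subseteq> cball 0 \<rho>"
    using sub ball_subset_cball by blast+
  show False
  proof (rule no_interior_contact[OF \<alpha> e _ _ _ _ \<kappa> m, where h = h and w = w and A = A and w' = w'])
    show "continuous_on (ball p e) A" using cA sub2(1) by (rule continuous_on_subset)
    show "w' p \<noteq> 0" using w'nz pb by simp
    show "cmod (h p) powr (2 * (1 - \<alpha>)) = \<kappa>\<^sup>2 * (cmod (w p))\<^sup>2 + \<phi> p" by (simp add: \<phi>_def)
    fix z assume z: "z \<in> ball p e"
    show "(h has_derivative (\<lambda>v. A z * v + of_real (cmod (h z) powr \<alpha>) * cnj (w' z) * cnj v)) (at z)"
      using hd z sub2(1) by blast
    show "(w has_field_derivative w' z) (at z)"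
      using wd z sub2(1) by blast
    show "cmod (h z) powr (2 * (1 - \<alpha>)) \<le> \<kappa>\<^sup>2 * (cmod (w z))\<^sup>2 + \<phi> p"
      using pmax[of z] z sub2(2) by (auto simp: \<phi>_def)
  qed
qed

text \<open>The power undoes the exponent in \<open>S_alpha\<close>. Both cases rest on
  \<open>\<alpha> * (2 - \<alpha>) \<le> 1\<close>; the first also uses
  \<open>2 - \<alpha> \<le> 4 * (1 - \<alpha>)\<close>, which is the condition
  \<open>\<alpha> \<le> 2 / 3\<close>.\<close>

lemma S_alpha_powr_le:
  assumes \<alpha>: "0 < \<alpha>" "\<alpha> < 1"
  shows "S_alpha \<alpha> powr (2 * (1 - \<alpha>)) \<le> (2 * (1 - \<alpha>) / (2 - \<alpha>))\<^sup>2"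
proof -
  have e: "1 / (2 - 2 * \<alpha>) * (2 * (1 - \<alpha>)) = 1" using \<alpha> by (simp add: field_simps)
  show ?thesis
  proof (cases "\<alpha> \<le> 2 / 3")
    case True
    have "S_alpha \<alpha> powr (2 * (1 - \<alpha>)) = \<alpha> * (1 - \<alpha>)"
      using True \<alpha> by (simp only: S_alpha_def if_True powr_powr e) simp
    also have "\<dots> \<le> (2 * (1 - \<alpha>) / (2 - \<alpha>))\<^sup>2"
    proof -
      have "\<alpha> * (2 - \<alpha>) \<le> 1"
        using zero_le_power2[of "1 - \<alpha>"] by (simp add: power2_eq_square algebra_simps)
      then have "\<alpha> * (2 - \<alpha>) * (2 - \<alpha>) \<le> 1 * (2 - \<alpha>)"
        using \<alpha> by (intro mult_right_mono) auto
      then have "\<alpha> * (2 - \<alpha>)\<^sup>2 \<le> 4 * (1 - \<alpha>)"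
        using True by (simp add: power2_eq_square algebra_simps)
      then have "(1 - \<alpha>) * (\<alpha> * (2 - \<alpha>)\<^sup>2) \<le> (1 - \<alpha>) * (4 * (1 - \<alpha>))"
        using \<alpha> by (intro mult_left_mono) auto
      also have "\<dots> = (2 * (1 - \<alpha>))\<^sup>2"
        by algebra
      finally have "\<alpha> * (1 - \<alpha>) * (2 - \<alpha>)\<^sup>2 \<le> (2 * (1 - \<alpha>))\<^sup>2"
        by (simp only: mult_ac)
      then show ?thesis
        unfolding power_divide by (rule mult_imp_le_div_pos[rotated]) (use \<alpha> in auto)
    qed
    finally show ?thesis .
  next
    case False
    have "S_alpha \<alpha> powr (2 * (1 - \<alpha>)) = 4 * \<alpha> * (1 - \<alpha>)\<^sup>2 / (2 - \<alpha>)"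
      using False \<alpha> by (simp only: S_alpha_def if_False powr_powr e) simp
    also have "\<dots> = (2 * (1 - \<alpha>) / (2 - \<alpha>))\<^sup>2 * (\<alpha> * (2 - \<alpha>))"
    proof -
      have "4 * \<alpha> * x\<^sup>2 / y = (2 * x / y)\<^sup>2 * (\<alpha> * y)" if "y \<noteq> 0" for x y :: real
        using that by (simp add: power2_eq_square field_simps)
      from this[of "2 - \<alpha>" "1 - \<alpha>"] show ?thesis using \<alpha> by simp
    qed
    also have "\<dots> \<le> (2 * (1 - \<alpha>) / (2 - \<alpha>))\<^sup>2 * 1"
    proof (intro mult_left_mono)
      show "\<alpha> * (2 - \<alpha>) \<le> 1"
        using zero_le_power2[of "1 - \<alpha>"] by (simp add: power2_eq_square algebra_simps)
    qed auto
    finally show ?thesis by simp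
  qed
qed

text \<open>A real-linear map on the plane is determined by its values at \<open>1\<close> and
  \<open>\<i>\<close>, and J-holomorphy expresses the second by the first. \<open>A\<close> is the
  Wirtinger derivative in \<open>z\<close> of the second component; the other one is
  \<open>- lam / 2 * cnj w'\<close>, so that the factor -2 in the given \<lambda> cancels.\<close>

lemma J_holomorphic_disk_components:
  assumes "J_holomorphic_disk S lam r Z"
  obtains A w' where
    "\<And>z. z \<in> ball 0 r \<Longrightarrow> (zc1 \<circ> Z has_field_derivative w' z) (at z)"
    "\<And>z. z \<in> ball 0 r \<Longrightarrow>
      (zc2 \<circ> Z has_derivative (\<lambda>v. A z * v + of_real (- lam (Z z) / 2) * cnj (w' z) * cnj v)) (at z)"
    "continuous_on (ball 0 r) A"
    "\<And>z. z \<in> ball 0 r \<Longrightarrow> w' z = zc1 (frechet_derivative Z (at z) 1)"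
proof -
  have Dsk: "Dsk r = ball 0 r" by (auto simp: Dsk_def)
  have "C1_on Z (ball 0 r)"
    using assms by (simp add: J_holomorphic_disk_def Dsk)
  then obtain D where D: "\<And>z. z \<in> ball 0 r \<Longrightarrow> (Z has_derivative blinfun_apply (D z)) (at z)"
    and cD: "continuous_on (ball 0 r) D"
    unfolding C1_on_def by blast
  have fd: "frechet_derivative Z (at z) = blinfun_apply (D z)" if "z \<in> ball 0 r" for z
    using frechet_derivative_at[OF D[OF that]] by simp
  have J: "D z (\<i> * v) = Jmat lam (Z z) *v D z v" if "z \<in> ball 0 r" for z v
    unfolding fd[OF that, symmetric] using assms that by (auto simp: J_holomorphic_disk_def Dsk)
  have lin: "D z v = Re v *\<^sub>R D z 1 + Im v *\<^sub>R D z \<i>" for z v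
  proof -
    have "D z v = D z (Re v *\<^sub>R 1 + Im v *\<^sub>R \<i>)"
      by (rule arg_cong[where f = "blinfun_apply (D z)"]) (simp add: complex_eq_iff)
    then show ?thesis by (simp add: blinfun.add_right blinfun.scaleR_right)
  qed
  note zc_lin = bounded_linear_zc[THEN bounded_linear.linear]
  define w' where "w' = (\<lambda>z. zc1 (D z 1))"
  define A where "A = (\<lambda>z. (zc2 (D z 1) - \<i> * zc2 (D z \<i>)) / 2)"
  have Ji: "zc1 (D z \<i>) = \<i> * w' z"
    "zc2 (D z \<i>) = \<i> * zc2 (D z 1) + \<i> * of_real (lam (Z z)) * cnj (w' z)" if "z \<in> ball 0 r" for z
    using J[OF that, of 1] by (simp_all add: zc_Jmat w'_def)
  have w'1: "zc1 (D z 1) = w' z" for z by (simp add: w'_def)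
  have "(zc1 \<circ> Z has_field_derivative w' z) (at z)" if z: "z \<in> ball 0 r" for z
  proof -
    have "((\<lambda>z. zc1 (Z z)) has_derivative (\<lambda>v. zc1 (D z v))) (at z)"
      by (rule bounded_linear.has_derivative[OF bounded_linear_zc(1) D[OF z]])
    moreover have "zc1 (D z v) = w' z * v" for v
      by (subst lin) (simp add: linear_add[OF zc_lin(1)] linear_cmul[OF zc_lin(1)] Ji[OF z] w'1 complex_eq_iff algebra_simps)
    ultimately show ?thesis by (simp add: has_field_derivative_def o_def)
  qed
  moreover have "(zc2 \<circ> Z has_derivative (\<lambda>v. A z * v + of_real (- lam (Z z) / 2) * cnj (w' z) * cnj v)) (at z)"
    if z: "z \<in> ball 0 r" for z
  proof -
    have "((\<lambda>z. zc2 (Z z)) has_derivative (\<lambda>v. zc2 (D z v))) (at z)"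
      by (rule bounded_linear.has_derivative[OF bounded_linear_zc(2) D[OF z]])
    moreover have "zc2 (D z v) = A z * v + of_real (- lam (Z z) / 2) * cnj (w' z) * cnj v" for v
      by (subst lin) (simp add: linear_add[OF zc_lin(2)] linear_cmul[OF zc_lin(2)] A_def Ji[OF z] complex_eq_iff field_simps)
    ultimately show ?thesis by (simp add: o_def)
  qed
  moreover have "continuous_on (ball 0 r) A"
  proof -
    have "continuous_on (ball 0 r) (\<lambda>z. zc2 (D z v))" for v
      by (rule bounded_linear.continuous_on[OF bounded_linear_zc(2)]) (intro continuous_intros cD)
    then show ?thesis unfolding A_def by (intro continuous_intros) auto
  qed
  moreover have "w' z = zc1 (frechet_derivative Z (at z) 1)" if "z \<in> ball 0 r" for z
    using fd[OF that] by (simp add: w'_def)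
  ultimately show thesis using that by blast
qed

lemma J_holomorphic_disk_radius_le:
  assumes \<alpha>: "0 < \<alpha>" "\<alpha> < 1" and b: "b \<noteq> 0" and r0: "r > 0"
    and J: "J_holomorphic_disk (S_alpha \<alpha>) (\<lambda>x. - 2 * cmod (zc2 x) powr \<alpha>) r Z"
    and Z0: "Z 0 = vec_of_C2 0 b" and dZ: "frechet_derivative Z (at 0) 1 = vec_of_C2 1 0"
  shows "r \<le> 4 * sqrt 2 / 3"
proof (rule ccontr)
  assume "\<not> r \<le> 4 * sqrt 2 / 3"
  then have r: "4 * sqrt 2 / 3 < r" by simp
  define w where "w = zc1 \<circ> Z"
  define h where "h = zc2 \<circ> Z"
  obtain A w' where
    wd: "\<And>z. z \<in> ball 0 r \<Longrightarrow> (w has_field_derivative w' z) (at z)"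
    and hd: "\<And>z. z \<in> ball 0 r \<Longrightarrow>
      (h has_derivative (\<lambda>v. A z * v + of_real (cmod (h z) powr \<alpha>) * cnj (w' z) * cnj v)) (at z)"
    and cA: "continuous_on (ball 0 r) A"
    and w'eq: "\<And>z. z \<in> ball 0 r \<Longrightarrow> w' z = zc1 (frechet_derivative Z (at z) 1)"
    by (rule J_holomorphic_disk_components[OF J]) (auto simp: w_def h_def)
  have range: "cmod (w z) < 2 \<and> cmod (h z) < S_alpha \<alpha>" if "cmod z < r" for z
  proof -
    have "Z z \<in> Omega (S_alpha \<alpha>)"
      using J that by (auto simp: J_holomorphic_disk_def Dsk_def)
    then show ?thesis by (simp add: Omega_def Dsk_def w_def h_def)
  qed
  have dw: "deriv w z = w' z" if "z \<in> ball 0 r" for z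
    using wd[OF that] by (rule DERIV_imp_deriv)
  have "w holomorphic_on ball 0 r"
    unfolding holomorphic_on_open[OF open_ball] using wd by blast
  moreover have w0: "w 0 = 0" by (simp add: w_def Z0)
  moreover have "deriv w 0 = 1" using dw[of 0] w'eq[of 0] r0 dZ by simp
  ultimately obtain \<rho> where \<rho>: "0 < \<rho>" "\<rho> < r" "\<And>z. cmod z < \<rho> \<Longrightarrow> deriv w z \<noteq> 0"
    "\<And>z. cmod z = \<rho> \<Longrightarrow> 1 \<le> cmod (w z)"
    using range r by (metis Landau_disc)
  \<comment> \<open>The largest value that \<open>max_principle_lower_bound\<close> admits. Its
    square is the bound in \<open>S_alpha_powr_le\<close>, so the boundary point obtained there
    contradicts \<open>|h| < S_alpha \<alpha>\<close>.\<close>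
  define \<kappa> where "\<kappa> = 2 * (1 - \<alpha>) / (2 - \<alpha>)"
  have \<kappa>: "0 < \<kappa>" "(2 - \<alpha>) * \<kappa> \<le> 2 * (1 - \<alpha>)" using \<alpha> by (auto simp: \<kappa>_def)
  have "w' z \<noteq> 0" if "z \<in> ball 0 \<rho>" for z
    using \<rho>(2,3) dw[of z] that by auto
  moreover have "h 0 \<noteq> 0" using b by (simp add: h_def Z0)
  ultimately obtain z where z: "z \<in> sphere 0 \<rho>" "\<kappa>\<^sup>2 < cmod (h z) powr (2 * (1 - \<alpha>))"
    using max_principle_lower_bound[OF \<alpha> \<rho>(1,2) hd cA wd w0 _ \<rho>(4) \<kappa>] by blast
  have "cmod (h z) powr (2 * (1 - \<alpha>)) \<le> S_alpha \<alpha> powr (2 * (1 - \<alpha>))"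
    using range[of z] z(1) \<rho>(2) \<alpha> by (intro powr_mono2) auto
  also have "\<dots> \<le> \<kappa>\<^sup>2"
    unfolding \<kappa>_def by (rule S_alpha_powr_le[OF \<alpha>])
  finally show False using z(2) by simp
qed

theorem theorem4p3:
  fixes \<alpha> :: real and b :: complex
  assumes "0 < \<alpha>" and "\<alpha> < 1"
    and "b \<in> Dsk (S_alpha \<alpha>)" and "b \<noteq> 0"
  shows "KR_pseudonorm (S_alpha \<alpha>) (\<lambda>x. - 2 * cmod (zc2 x) powr \<alpha>)
           (vec_of_C2 0 b) (vec_of_C2 1 0) \<ge> 3 / (4 * sqrt 2)"
  unfolding KR_pseudonorm_def
proof (rule cInf_greatest)
  show "{1 / r | r. r > 0 \<and>
      (\<exists>Z. J_holomorphic_disk (S_alpha \<alpha>) (\<lambda>x. - 2 * cmod (zc2 x) powr \<alpha>) r Z \<and>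
         Z 0 = vec_of_C2 0 b \<and> frechet_derivative Z (at 0) 1 = vec_of_C2 1 0)} \<noteq> {}"
    using exists_J_holomorphic_disk[of b "S_alpha \<alpha>" \<alpha>] assms by (auto simp: Dsk_def)
next
  fix x
  assume "x \<in> {1 / r | r. r > 0 \<and>
      (\<exists>Z. J_holomorphic_disk (S_alpha \<alpha>) (\<lambda>x. - 2 * cmod (zc2 x) powr \<alpha>) r Z \<and>
         Z 0 = vec_of_C2 0 b \<and> frechet_derivative Z (at 0) 1 = vec_of_C2 1 0)}"
  then obtain r where r: "x = 1 / r" "r > 0" "r \<le> 4 * sqrt 2 / 3"
    using J_holomorphic_disk_radius_le[OF assms(1,2,4)] by blast
  show "3 / (4 * sqrt 2) \<le> x"
    unfolding r(1) using r(2,3) by (simp add: field_simps)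
qed

end
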